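(* Let $\rho_{AB}$ be a two-qubit state. Then $\rho_{AB}$ admits a symmetric extension if and only if $$\operatorname{tr}(\rho_B^2)\;\geq\;\operatorname{tr}(\rho_{AB}^2)-4\sqrt{\det\rho_{AB}} .$$
   Context: A two-qubit state $\rho_{AB}$ is a positive semidefinite operator of trace one on $\mathbb{C}^2_A\otimes\mathbb{C}^2_B$ (a $4\times4$ density matrix); $\rho_B=\operatorname{tr}_A(\rho_{AB})$ is its reduced state on $B$. The state $\rho_{AB}$ admits a symmetric extension (is symmetric extendible) if there exists a state (positive semidefinite, trace one) $\rho_{ABB'}$ on $\mathbb{C}^2_A\otimes\mathbb{C}^2_B\otimes\mathbb{C}^2_{B'}$ whose marginals on $AB$ and on $AB'$ both equal $\rho_{AB}$, i.e. $\operatorname{tr}_{B'}(\rho_{ABB'})=\rho_{AB}$ and $\operatorname{tr}_{B}(\rho_{ABB'})=\rho_{AB}$ (with $B'$ identified with $B$). *)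

theory Defs
  imports "HOL-Analysis.Analysis"
begin

(* Operators on a tensor product of coordinate spaces C^'a and C^'b are matrices with respect
   to the product basis, i.e. square matrices with index type 'a \<times> 'b.  The numeral type 2
   indexes the standard basis of a qubit, so a two-qubit operator is a 4 x 4 matrix. *)

definition hermitian :: "complex^'n^'n \<Rightarrow> bool" where
  "hermitian M \<longleftrightarrow> (\<forall>i j. M $ j $ i = cnj (M $ i $ j))"

(* For Hermitian M the form below is real-valued, so taking its real part loses nothing. *)
definition psd :: "complex^'n^'n \<Rightarrow> bool" where
  "psd M \<longleftrightarrow> hermitian M \<and> (\<forall>v. 0 \<le> Re (\<Sum>i\<in>UNIV. cnj (v $ i) * (M *v v) $ i))"

definition state :: "complex^'n^'n \<Rightarrow> bool" where
  "state \<rho> \<longleftrightarrow> psd \<rho> \<and> trace \<rho> = 1"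

definition ptrace_A ::
    "complex^('a::finite \<times> 'b::finite)^('a \<times> 'b) \<Rightarrow> complex^'b^'b" where
  "ptrace_A \<rho> = (\<chi> i j. \<Sum>a\<in>UNIV. \<rho> $ (a, i) $ (a, j))"

(* Tripartite operators: the index (a, b, c) is a \<in> A, b \<in> B, c \<in> B'.
   The primed version traces out the last factor B', the other one the middle factor B. *)
definition ptrace_B' ::
    "complex^('a::finite \<times> 'b::finite \<times> 'c::finite)^('a \<times> 'b \<times> 'c)
      \<Rightarrow> complex^('a \<times> 'b)^('a \<times> 'b)" where
  "ptrace_B' \<rho> = (\<chi> i j. \<Sum>c\<in>UNIV. \<rho> $ (fst i, snd i, c) $ (fst j, snd j, c))"

definition ptrace_B ::
    "complex^('a::finite \<times> 'b::finite \<times> 'c::finite)^('a \<times> 'b \<times> 'c)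
      \<Rightarrow> complex^('a \<times> 'c)^('a \<times> 'c)" where
  "ptrace_B \<rho> = (\<chi> i j. \<Sum>b\<in>UNIV. \<rho> $ (fst i, b, snd i) $ (fst j, b, snd j))"

definition symmetric_extendible :: "complex^('a::finite \<times> 'b::finite)^('a \<times> 'b) \<Rightarrow> bool" where
  "symmetric_extendible \<rho> \<longleftrightarrow>
     (\<exists>\<sigma> :: complex^('a \<times> 'b \<times> 'b)^('a \<times> 'b \<times> 'b).
        state \<sigma> \<and> ptrace_B' \<sigma> = \<rho> \<and> ptrace_B \<sigma> = \<rho>)"

end

theory Submission
  imports Defs
begin

text \<open>
  Write \<open>\<rho>\<close> as a \<open>2 \<times> 2\<close> matrix of blocks acting on \<open>A\<close>, indexed by the basis of \<open>B\<close>: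
  \<open>\<rho> = [[A, X], [X\<^sup>*, D]]\<close>. The criterion says that
  \<open>gap \<rho> = 2 det A + 2 det D + 2 (det (X + X\<^sup>*) - 2 Re (det X)) + 4 sqrt (det \<rho>)\<close> is nonnegative;
  this expression scales by \<open>\<bar>det g\<bar>\<^sup>2\<close> under \<open>g \<otimes> 1\<close> and increases with \<open>A\<close> and \<open>D\<close>.

  An extension provides \<open>m\<close> and \<open>X = x + y\<close> with \<open>[[A - m, x], [x\<^sup>*, m]]\<close> and
  \<open>[[m, y], [y\<^sup>*, D - m]]\<close> positive semidefinite. After normalising \<open>m = 1\<close> and decreasing \<open>A\<close>, \<open>D\<close> to
  \<open>1 + x x\<^sup>*\<close>, \<open>1 + y\<^sup>* y\<close>, the gap becomes
  \<open>2 \<bar>det x - det y\<bar>\<^sup>2 + 2 \<bar>tr x + tr y\<bar>\<^sup>2 + 4 (\<bar>z\<bar> + Re z)\<close> with \<open>z = det (1 - x y\<^sup>*)\<close>,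
  which is nonnegative.

  Conversely, if \<open>\<rho>\<close> is not extendible, convex duality yields \<open>s > 0\<close> such that \<open>\<rho> + s 1\<close> is
  extendible and is annihilated by some nonzero \<open>H\<close> of the dual cone. Complementary slackness
  forces \<open>det x = det y\<close>, \<open>tr x = - tr y\<close> and \<open>z \<le> 0\<close> for \<open>\<rho> + s 1\<close>, so its gap
  vanishes. As the gap increases strictly with \<open>s\<close>, the gap of \<open>\<rho>\<close> is negative.
\<close>

section \<open>Matrices, positive semidefiniteness and blocks\<close>

definition dagger :: "complex^'n^'m \<Rightarrow> complex^'m^'n" where
  "dagger M = (\<chi> i j. cnj (M $ j $ i))"

definition cip :: "complex^'n \<Rightarrow> complex^'n \<Rightarrow> complex" where
  "cip u v = (\<Sum>i\<in>UNIV. cnj (u $ i) * v $ i)"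

lemma dagger_nth [simp]: "dagger M $ i $ j = cnj (M $ j $ i)"
  by (simp add: dagger_def)

lemma dagger_dagger [simp]: "dagger (dagger M) = M"
  by (simp add: vec_eq_iff)

lemma dagger_add [simp]: "dagger (M + N) = dagger M + dagger N"
  by (simp add: vec_eq_iff)

lemma dagger_diff [simp]: "dagger (M - N) = dagger M - dagger N"
  by (simp add: vec_eq_iff)

lemma dagger_minus [simp]: "dagger (- M) = - dagger M"
  by (simp add: vec_eq_iff)

lemma dagger_0 [simp]: "dagger 0 = 0"
  by (simp add: vec_eq_iff)

lemma dagger_mat_1 [simp]: "dagger (mat 1) = mat 1"
  by (auto simp: vec_eq_iff mat_def)

lemma dagger_scaleR [simp]: "dagger (r *\<^sub>R M) = r *\<^sub>R dagger M"
  by (simp add: vec_eq_iff)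

lemma dagger_mult: "dagger (M ** N) = dagger N ** dagger M"
  by (simp add: vec_eq_iff matrix_matrix_mult_def mult.commute)

lemma det_dagger: "det (dagger M) = cnj (det (M :: complex^'n^'n))"
proof -
  have "det (dagger M) = det (transpose (dagger M))"
    by simp
  also have "\<dots> = cnj (det M)"
    by (simp add: det_def transpose_def)
  finally show ?thesis .
qed

lemma trace_dagger: "trace (dagger M) = cnj (trace M)"
  by (simp add: trace_def)

lemma hermitian_iff_dagger: "hermitian M \<longleftrightarrow> dagger M = M"
  unfolding hermitian_def vec_eq_iff dagger_nth by metis

lemma matrix_minus_left: "(- A) ** B = - (A ** B :: 'a::comm_ring_1^'n^'m)"
  by (simp add: vec_eq_iff matrix_matrix_mult_def sum_negf)

lemma matrix_minus_right: "A ** (- B) = - (A ** B :: 'a::comm_ring_1^'n^'m)"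
  by (simp add: vec_eq_iff matrix_matrix_mult_def sum_negf)

lemma matrix_add_left: "(A + B) ** C = A ** C + B ** (C :: 'a::comm_ring_1^'n^'m)"
  by (simp add: vec_eq_iff matrix_matrix_mult_def sum.distrib algebra_simps)

lemma matrix_diff_left: "(A - B) ** C = A ** C - B ** (C :: 'a::comm_ring_1^'n^'m)"
  by (simp add: vec_eq_iff matrix_matrix_mult_def sum_subtractf algebra_simps)

lemma matrix_diff_right: "A ** (B - C) = A ** B - A ** (C :: 'a::comm_ring_1^'n^'m)"
  by (simp add: vec_eq_iff matrix_matrix_mult_def sum_subtractf algebra_simps)

lemma matrix_zero_left [simp]: "(0 :: 'a::comm_ring_1^'k^'m) ** B = 0"
  by (simp add: vec_eq_iff matrix_matrix_mult_def)

lemma matrix_zero_right [simp]: "B ** (0 :: 'a::comm_ring_1^'n^'k) = 0"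
  by (simp add: vec_eq_iff matrix_matrix_mult_def)

lemmas matrix_ring_simps = matrix_add_ldistrib matrix_add_left matrix_diff_left
  matrix_diff_right matrix_minus_left matrix_minus_right matrix_mul_assoc

lemma matrix_inv_mult:
  fixes A :: "'a::field^'n^'n"
  assumes "det A \<noteq> 0"
  shows "A ** matrix_inv A = mat 1" "matrix_inv A ** A = mat 1"
  using someI_ex[of "\<lambda>B. A ** B = mat 1 \<and> B ** A = mat 1"] assms
  by (simp_all add: invertible_det_nz[symmetric] matrix_inv_def invertible_def)

lemma cip_add_right: "cip u (v + w) = cip u v + cip u w"
  by (simp add: cip_def sum.distrib algebra_simps)

lemma cip_add_left: "cip (u + v) w = cip u w + cip v w"
  by (simp add: cip_def sum.distrib algebra_simps)

lemma cip_diff_right: "cip u (v - w) = cip u v - cip u w"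
  by (simp add: cip_def sum_subtractf algebra_simps)

lemma cip_diff_left: "cip (u - v) w = cip u w - cip v w"
  by (simp add: cip_def sum_subtractf algebra_simps)

lemma cip_smult_right: "cip u (c *s v) = c * cip u v"
  by (simp add: cip_def sum_distrib_left algebra_simps)

lemma cip_smult_left: "cip (c *s u) v = cnj c * cip u v"
  by (simp add: cip_def sum_distrib_left algebra_simps)

lemma cip_zero [simp]: "cip 0 v = 0" "cip u 0 = 0"
  by (simp_all add: cip_def)

lemma cip_commute: "cip v u = cnj (cip u v)"
  by (simp add: cip_def mult.commute)

lemma cip_matrix: "cip u (A *v v) = cip (dagger A *v u) v"
proof -
  have "cip u (A *v v) = (\<Sum>i\<in>UNIV. \<Sum>j\<in>UNIV. cnj (u $ i) * (A $ i $ j * v $ j))"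
    by (simp add: cip_def matrix_vector_mult_def sum_distrib_left)
  also have "\<dots> = (\<Sum>j\<in>UNIV. \<Sum>i\<in>UNIV. cnj (u $ i) * (A $ i $ j * v $ j))"
    by (rule sum.swap)
  also have "\<dots> = cip (dagger A *v u) v"
    by (simp add: cip_def matrix_vector_mult_def sum_distrib_left sum_distrib_right mult_ac)
  finally show ?thesis .
qed

lemma cip_self: "cip v v = of_real ((norm v)\<^sup>2)"
proof -
  have "cip v v = (\<Sum>i\<in>UNIV. of_real ((norm (v $ i))\<^sup>2))"
    unfolding cip_def by (intro sum.cong refl) (metis complex_norm_square mult.commute)
  then show ?thesis
    by (simp add: norm_vec_def L2_set_def sum_nonneg)
qed

lemma matrix_vector_smult: "A *v (c *s v) = c *s (A *v (v :: 'a::comm_ring_1^'n))"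
  by (simp add: vec_eq_iff matrix_vector_mult_def sum_distrib_left algebra_simps)

lemma psd_iff: "psd M \<longleftrightarrow> dagger M = M \<and> (\<forall>v. 0 \<le> Re (cip v (M *v v)))"
  by (simp add: psd_def hermitian_iff_dagger cip_def)

lemma psd_dagger: "psd M \<Longrightarrow> dagger M = M"
  by (simp add: psd_iff)

lemma psd_cip: "psd M \<Longrightarrow> 0 \<le> Re (cip v (M *v v))"
  by (simp add: psd_iff)

lemma psd_congruence: "psd M \<Longrightarrow> psd (A ** M ** dagger A)"
proof -
  assume M: "psd M"
  have "cip v ((A ** M ** dagger A) *v v) = cip (dagger A *v v) (M *v (dagger A *v v))" for v
    using cip_matrix[of v A "M *v (dagger A *v v)"] by (simp add: matrix_vector_mul_assoc matrix_mul_assoc)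
  with M show ?thesis
    by (simp add: psd_iff dagger_mult matrix_mul_assoc)
qed

lemma psd_add: "psd M \<Longrightarrow> psd N \<Longrightarrow> psd (M + N)"
  by (simp add: psd_iff matrix_vector_mult_add_rdistrib cip_add_right)

lemma scaleR_matrix_vector: "(r *\<^sub>R M) *v v = complex_of_real r *s (M *v v)"
  by (simp add: vec_eq_iff matrix_vector_mult_def scaleR_conv_of_real[where 'a=complex] sum_distrib_left mult_ac)

lemma psd_scaleR: "0 \<le> r \<Longrightarrow> psd M \<Longrightarrow> psd (r *\<^sub>R M)"
  by (simp add: psd_iff scaleR_matrix_vector cip_smult_right)

lemma psd_zero: "psd 0"
  by (simp add: psd_iff)

lemma psd_mat_1: "psd (mat 1)"
  by (simp add: psd_iff cip_self)

definition outer :: "complex^'m \<Rightarrow> complex^'n \<Rightarrow> complex^'n^'m" where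
  "outer u v = (\<chi> i j. u $ i * cnj (v $ j))"

lemma trace_mult_outer: "trace (M ** outer u v) = cip v (M *v u)"
  by (simp add: outer_def trace_def matrix_matrix_mult_def matrix_vector_mult_def cip_def sum_distrib_left mult_ac)

lemma psd_outer: "psd (outer v v)"
proof -
  have "cip w (outer v v *v w) = of_real ((norm (cip v w))\<^sup>2)" for w
  proof -
    have "outer v v *v w = cip v w *s v"
      by (simp add: outer_def vec_eq_iff matrix_vector_mult_def cip_def sum_distrib_left sum_distrib_right mult_ac)
    then show ?thesis
      using complex_norm_square[of "cip v w"] by (simp add: cip_smult_right cip_commute[of w v])
  qed
  then show ?thesis
    by (simp add: psd_iff vec_eq_iff outer_def)
qed

text \<open>The form stays nonnegative along \<open>v + t *s (M *v v)\<close> for every real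
  \<open>t\<close>. As a quadratic in \<open>t\<close> it has constant term 0, so its linear
  coefficient, twice the squared norm of \<open>M *v v\<close>, must vanish.\<close>

lemma psd_cip_zero:
  assumes "psd M" and "Re (cip v (M *v v)) = 0"
  shows "M *v v = 0"
proof -
  let ?w = "M *v v"
  let ?q = "Re (cip ?w (M *v ?w))"
  have M: "dagger M = M"
    using assms by (simp add: psd_dagger)
  have *: "0 \<le> 2 * t * (norm ?w)\<^sup>2 + t\<^sup>2 * ?q" for t :: real
  proof -
    have "Re (cip (v + of_real t *s ?w) (M *v (v + of_real t *s ?w))) = 2 * t * (norm ?w)\<^sup>2 + t\<^sup>2 * ?q"
      using assms(2) cip_matrix[of v M ?w]
      by (simp add: M matrix_vector_right_distrib matrix_vector_smult cip_add_left cip_add_right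
          cip_smult_left cip_smult_right cip_self power2_eq_square distrib_left)
    with psd_cip[OF assms(1)] show ?thesis
      by metis
  qed
  have "(norm ?w)\<^sup>2 = 0"
  proof (rule ccontr)
    assume "(norm ?w)\<^sup>2 \<noteq> 0"
    define N where "N = (norm ?w)\<^sup>2"
    have N: "N > 0" using \<open>(norm ?w)\<^sup>2 \<noteq> 0\<close> by (simp add: N_def)
    have q: "?q \<ge> 0" using assms(1) by (rule psd_cip)
    \<comment> \<open>A negative \<open>t\<close> small enough for the linear term to dominate; the
      summand 1 keeps the denominator positive when \<open>?q = 0\<close>.\<close>
    define t where "t = - N / (?q + 1)"
    have "2 * t * N + t\<^sup>2 * ?q = - (N\<^sup>2 / (?q + 1)\<^sup>2) * (?q + 2)"
      using q unfolding t_def by (simp add: power2_eq_square divide_simps) (simp add: algebra_simps)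
    also have "\<dots> < 0"
      using q N by (intro mult_neg_pos) (auto simp: divide_pos_pos)
    finally show False
      using *[of t] by (simp add: N_def)
  qed
  then show ?thesis by simp
qed

section \<open>Block matrices over a qubit factor\<close>

lemma sum_prod_2: "(\<Sum>i\<in>UNIV. f i) = (\<Sum>a\<in>UNIV. f (a, 1)) + (\<Sum>a\<in>UNIV. f (a, 2 :: 2))"
  for f :: "'a::finite \<times> 2 \<Rightarrow> 'b::comm_monoid_add"
proof -
  have "(\<Sum>i\<in>UNIV. f i) = (\<Sum>a\<in>UNIV. \<Sum>b\<in>UNIV. f (a, b))"
    by (simp add: sum.cartesian_product)
  then show ?thesis
    by (simp add: sum_2 sum.distrib)
qed

definition blk :: "complex^'a^'a \<Rightarrow> complex^'a^'a \<Rightarrow> complex^'a^'a \<Rightarrow> complex^'a^'a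
    \<Rightarrow> complex^('a::finite \<times> 2)^('a \<times> 2)" where
  "blk A B C D = (\<chi> i j. (if snd i = 1 then if snd j = 1 then A else B
     else if snd j = 1 then C else D) $ fst i $ fst j)"

definition vblk :: "complex^'a \<Rightarrow> complex^'a \<Rightarrow> complex^('a::finite \<times> 2)" where
  "vblk u v = (\<chi> i. (if snd i = 1 then u else v) $ fst i)"

lemma blk_nth [simp]:
  "blk A B C D $ (a, 1) $ (a', 1) = A $ a $ a'" "blk A B C D $ (a, 1) $ (a', 2) = B $ a $ a'"
  "blk A B C D $ (a, 2) $ (a', 1) = C $ a $ a'" "blk A B C D $ (a, 2) $ (a', 2) = D $ a $ a'"
  by (simp_all add: blk_def)

lemma vblk_nth [simp]: "vblk u v $ (a, 1) = u $ a" "vblk u v $ (a, 2) = v $ a"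
  by (simp_all add: vblk_def)

lemma vec_eq_iff_prod_2: "u = v \<longleftrightarrow> (\<forall>a. u $ (a, 1) = v $ (a, 1) \<and> u $ (a, 2) = v $ (a, 2 :: 2))"
  by (auto simp: vec_eq_iff forall_2)

lemma blk_exhaust:
  obtains A B C D where "M = blk A B C D"
proof
  show "M = blk (\<chi> a a'. M $ (a, 1) $ (a', 1)) (\<chi> a a'. M $ (a, 1) $ (a', 2))
    (\<chi> a a'. M $ (a, 2) $ (a', 1)) (\<chi> a a'. M $ (a, 2) $ (a', 2))"
    by (simp add: vec_eq_iff_prod_2)
qed

lemma vblk_exhaust:
  obtains u v where "w = vblk u v"
proof
  show "w = vblk (\<chi> a. w $ (a, 1)) (\<chi> a. w $ (a, 2))"
    by (simp add: vec_eq_iff_prod_2)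
qed

lemma blk_eq_iff: "blk A B C D = blk A' B' C' D' \<longleftrightarrow> A = A' \<and> B = B' \<and> C = C' \<and> D = D'"
  by (auto simp: vec_eq_iff_prod_2 vec_eq_iff)

lemma vblk_eq_iff: "vblk u v = vblk u' v' \<longleftrightarrow> u = u' \<and> v = v'"
  by (auto simp: vec_eq_iff_prod_2 vec_eq_iff)

lemma vblk_zero: "vblk 0 0 = 0"
  by (simp add: vec_eq_iff_prod_2)

lemma dagger_blk: "dagger (blk A B C D) = blk (dagger A) (dagger C) (dagger B) (dagger D)"
  by (simp add: vec_eq_iff_prod_2)

lemma blk_mult: "blk A B C D ** blk A' B' C' D' =
    blk (A ** A' + B ** C') (A ** B' + B ** D') (C ** A' + D ** C') (C ** B' + D ** D')"
  by (simp add: vec_eq_iff_prod_2 matrix_matrix_mult_def sum_prod_2)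

lemma blk_mult_vblk: "blk A B C D *v vblk u v = vblk (A *v u + B *v v) (C *v u + D *v v)"
  by (simp add: vec_eq_iff_prod_2 matrix_vector_mult_def sum_prod_2)

lemma cip_vblk: "cip (vblk u v) (vblk u' v') = cip u u' + cip v v'"
  by (simp add: cip_def sum_prod_2)

lemma blk_add: "blk A B C D + blk A' B' C' D' = blk (A + A') (B + B') (C + C') (D + D')"
  by (simp add: vec_eq_iff_prod_2)

lemma blk_scaleR: "r *\<^sub>R blk A B C D = blk (r *\<^sub>R A) (r *\<^sub>R B) (r *\<^sub>R C) (r *\<^sub>R D)"
  by (simp add: vec_eq_iff_prod_2)

lemma blk_mat_1: "blk (mat 1) 0 0 (mat 1) = mat 1"
  by (simp add: vec_eq_iff_prod_2 mat_def)

lemma trace_blk: "trace (blk A B C D) = trace A + trace D"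
  by (simp add: trace_def sum_prod_2)

lemma psd_blk_iff: "psd (blk A B C D) \<longleftrightarrow> dagger A = A \<and> dagger D = D \<and> C = dagger B \<and>
    (\<forall>u v. 0 \<le> Re (cip u (A *v u)) + 2 * Re (cip u (B *v v)) + Re (cip v (D *v v)))"
proof (cases "C = dagger B")
  case True
  have "(\<forall>w. 0 \<le> Re (cip w (blk A B C D *v w))) \<longleftrightarrow>
      (\<forall>u v. 0 \<le> Re (cip (vblk u v) (blk A B C D *v vblk u v)))"
    by (metis vblk_exhaust)
  moreover have "Re (cip (vblk u v) (blk A B C D *v vblk u v)) =
      Re (cip u (A *v u)) + 2 * Re (cip u (B *v v)) + Re (cip v (D *v v))" for u v
    using cip_matrix[of v C u] cip_commute[of "B *v v" u]
    by (simp add: True blk_mult_vblk cip_vblk cip_add_right)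
  ultimately show ?thesis
    by (auto simp: psd_iff dagger_blk blk_eq_iff True)
next
  case False
  then show ?thesis
    by (auto simp: psd_iff dagger_blk blk_eq_iff)
qed

lemma psd_blk_diag:
  assumes "psd (blk A B C D)"
  shows "psd A" and "psd D"
proof -
  show "psd A"
    unfolding psd_iff using assms[unfolded psd_blk_iff]
    by (metis add.right_neutral cip_zero(1) cip_zero(2) matrix_vector_mult_0_right mult_zero_right zero_complex.simps(1))
  show "psd D"
    unfolding psd_iff using assms[unfolded psd_blk_iff]
    by (metis add_0 cip_zero(1) cip_zero(2) matrix_vector_mult_0_right mult_zero_right zero_complex.simps(1))
qed

lemma psd_blk_swap: "psd (blk A B C D) \<Longrightarrow> psd (blk D C B A)"
proof -
  assume "psd (blk A B C D)"
  then have "psd (blk 0 (mat 1) (mat 1) 0 ** blk A B C D ** dagger (blk 0 (mat 1) (mat 1) 0))"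
    by (rule psd_congruence)
  then show ?thesis
    by (simp add: dagger_blk blk_mult)
qed

lemma psd_blk_diagI: "psd A \<Longrightarrow> psd D \<Longrightarrow> psd (blk A 0 0 D)"
  by (simp add: psd_blk_iff psd_iff[of A] psd_iff[of D])

section \<open>Determinants and \<open>2 \<times> 2\<close> positive semidefinite blocks\<close>

lemma UNIV_2_times_2: "(UNIV :: (2 \<times> 2) set) = {(1, 1), (2, 1), (1, 2), (2, 2)}"
  by (auto simp: UNIV_Times_UNIV[symmetric] UNIV_2 simp del: UNIV_Times_UNIV)

text \<open>The Leibniz formula with all 24 permutations written out, so that determinant identities
  for \<open>blk\<close> become polynomial identities in the entries.\<close>

lemma det_2_times_2:
  fixes M :: "'a::comm_ring_1^(2 \<times> 2)^(2 \<times> 2)"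
  defines "m a b c d \<equiv> M $ (1, 1) $ a * M $ (2, 1) $ b * M $ (1, 2) $ c * M $ (2, 2) $ d"
  shows "det M =
    m (1,1) (2,1) (1,2) (2,2) - m (1,1) (2,1) (2,2) (1,2) - m (1,1) (1,2) (2,1) (2,2)
    + m (1,1) (1,2) (2,2) (2,1) + m (1,1) (2,2) (2,1) (1,2) - m (1,1) (2,2) (1,2) (2,1)
    - m (2,1) (1,1) (1,2) (2,2) + m (2,1) (1,1) (2,2) (1,2) + m (2,1) (1,2) (1,1) (2,2)
    - m (2,1) (1,2) (2,2) (1,1) - m (2,1) (2,2) (1,1) (1,2) + m (2,1) (2,2) (1,2) (1,1)
    + m (1,2) (1,1) (2,1) (2,2) - m (1,2) (1,1) (2,2) (2,1) - m (1,2) (2,1) (1,1) (2,2)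
    + m (1,2) (2,1) (2,2) (1,1) + m (1,2) (2,2) (1,1) (2,1) - m (1,2) (2,2) (2,1) (1,1)
    - m (2,2) (1,1) (2,1) (1,2) + m (2,2) (1,1) (1,2) (2,1) + m (2,2) (2,1) (1,1) (1,2)
    - m (2,2) (2,1) (1,2) (1,1) - m (2,2) (1,2) (1,1) (2,1) + m (2,2) (1,2) (2,1) (1,1)"
proof -
  have 1: "finite {(2::2, 1::2), (1, 2), (2, 2)}" "(1, 1) \<notin> {(2::2, 1::2), (1, 2), (2, 2)}"
    and 2: "finite {(1::2, 2::2), (2, 2)}" "(2, 1) \<notin> {(1::2, 2::2), (2, 2)}"
    and 3: "finite {(2::2, 2::2)}" "(1, 2) \<notin> {(2::2, 2::2)}"
    by auto
  show ?thesis
    unfolding det_def UNIV_2_times_2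
    unfolding sum_over_permutations_insert[OF 1]
    unfolding sum_over_permutations_insert[OF 2]
    unfolding sum_over_permutations_insert[OF 3]
    unfolding permutes_sing
    by (simp add: sign_swap_id permutation_swap_id sign_compose permutation_compose sign_id
        swap_id_eq m_def algebra_simps)
qed

lemma det_blk_lower: "det (blk A 0 C D) = det A * det (D :: complex^2^2)"
  by (simp add: det_2_times_2 det_2 algebra_simps)

lemma det_blk_upper: "det (blk A B 0 D) = det A * det (D :: complex^2^2)"
  by (simp add: det_2_times_2 det_2 algebra_simps)

text \<open>Block LU factorisation leaves the Schur complement as the only nontrivial diagonal
  block.\<close>

lemma det_blk_unit: "det (blk (mat 1) B C (mat 1)) = det (mat 1 - C ** (B :: complex^2^2))"
proof -
  have "blk (mat 1) B C (mat 1) = blk (mat 1) 0 C (mat 1) ** blk (mat 1) B 0 (mat 1 - C ** B)"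
    by (simp add: blk_mult)
  then show ?thesis
    by (simp add: det_mul det_blk_lower det_blk_upper)
qed

text \<open>The flip \<open>?W\<close> of the qubit basis is an involution, so its determinant
  squares to 1 and conjugation by it preserves determinants.\<close>

lemma det_blk_swap: "det (blk D C B A) = det (blk A B C (D :: complex^2^2))"
proof -
  let ?W = "blk 0 (mat 1) (mat 1) 0 :: complex^(2 \<times> 2)^(2 \<times> 2)"
  have "det ?W * det ?W = det (?W ** ?W)"
    by (simp only: det_mul)
  also have "\<dots> = 1"
    by (simp add: blk_mult blk_mat_1)
  finally have "det ?W * det ?W = 1" .
  moreover have "blk D C B A = ?W ** blk A B C D ** ?W"
    by (simp add: blk_mult)
  ultimately show ?thesis
    by (simp add: det_mul)
qed

lemma det_zero_ker:
  fixes M :: "'a::field^'n^'n"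
  shows "det M = 0 \<longleftrightarrow> (\<exists>v. v \<noteq> 0 \<and> M *v v = 0)"
  using matrix_left_invertible_ker[of M] invertible_det_nz[of M] invertible_left_inverse[of M] by blast

lemma dagger_matrix_inv:
  assumes "det A \<noteq> 0"
  shows "dagger (matrix_inv A) = matrix_inv (dagger A)"
proof -
  have d: "det (dagger A) \<noteq> 0"
    using assms by (simp add: det_dagger)
  have "dagger (matrix_inv A) ** dagger A = mat 1"
    using matrix_inv_mult[OF assms] by (simp add: dagger_mult[symmetric])
  then have "dagger (matrix_inv A) ** (dagger A ** matrix_inv (dagger A)) = matrix_inv (dagger A)"
    by (simp add: matrix_mul_assoc)
  then show ?thesis
    by (simp add: matrix_inv_mult[OF d])
qed

text \<open>Block Gaussian elimination as a congruence: \<open>?L\<close> is lower unitriangular, so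
  it preserves positivity and the determinant while making the matrix block diagonal.\<close>

lemma psd_schur:
  assumes "psd (blk A B C D)" and "det A \<noteq> 0"
  shows "psd (D - C ** matrix_inv A ** B)"
    and "det (blk A B C D) = det A * det (D - C ** matrix_inv A ** (B :: complex^2^2))"
proof -
  let ?I = "matrix_inv A"
  let ?L = "blk (mat 1) 0 (- (C ** ?I)) (mat 1)"
  note inv = matrix_inv_mult[OF assms(2)]
  have A: "dagger A = A" "dagger D = D" "C = dagger B"
    using assms(1) by (auto simp: psd_blk_iff)
  have I: "dagger ?I = ?I"
    using dagger_matrix_inv[OF assms(2)] A by simp
  have BI: "dagger B ** ?I ** A = dagger B" "A ** ?I ** B = B"
    using inv by (simp_all add: matrix_mul_assoc[symmetric])
  have L: "?L ** blk A B C D ** dagger ?L = blk A 0 0 (D - C ** ?I ** B)"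
    by (simp add: dagger_blk blk_mult dagger_mult A I matrix_ring_simps BI)
  show "psd (D - C ** ?I ** B)"
    using psd_congruence[OF assms(1), of ?L] unfolding L by (rule psd_blk_diag)
  have "det (?L ** blk A B C D ** dagger ?L) = det (blk A B C D)"
    by (simp add: det_mul det_dagger det_blk_lower)
  then show "det (blk A B C D) = det A * det (D - C ** ?I ** B)"
    unfolding L by (simp add: det_blk_lower)
qed

section \<open>Cholesky factors of 2 x 2 matrices and determinant inequalities\<close>

lemma psd_2_entries:
  fixes A :: "complex^2^2"
  assumes "psd A"
  shows "A $ 1 $ 1 = of_real (Re (A $ 1 $ 1))" "A $ 2 $ 2 = of_real (Re (A $ 2 $ 2))"
    "A $ 2 $ 1 = cnj (A $ 1 $ 2)" "0 \<le> Re (A $ 1 $ 1)" "0 \<le> Re (A $ 2 $ 2)"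
    "(norm (A $ 1 $ 2))\<^sup>2 \<le> Re (A $ 1 $ 1) * Re (A $ 2 $ 2)"
proof -
  have herm: "A $ i $ j = cnj (A $ j $ i)" for i j
    using arg_cong[OF psd_dagger[OF assms], of "\<lambda>M. M $ i $ j"] by simp
  have "A $ i $ i = of_real (Re (A $ i $ i))" for i
    using herm[of i i] by (simp add: complex_eq_iff)
  then show r: "A $ 1 $ 1 = of_real (Re (A $ 1 $ 1))" "A $ 2 $ 2 = of_real (Re (A $ 2 $ 2))"
    by blast+
  show h: "A $ 2 $ 1 = cnj (A $ 1 $ 2)"
    by (rule herm)
  have q: "0 \<le> Re (cip v (A *v v))" for v
    using assms by (rule psd_cip)
  show a: "0 \<le> Re (A $ 1 $ 1)"
    using q[of "vector [1, 0]"] by (simp add: cip_def sum_2 matrix_vector_mult_def)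
  show d: "0 \<le> Re (A $ 2 $ 2)"
    using q[of "vector [0, 1]"] by (simp add: cip_def sum_2 matrix_vector_mult_def)
  let ?a = "Re (A $ 1 $ 1)" and ?d = "Re (A $ 2 $ 2)" and ?b = "A $ 1 $ 2"
  \<comment> \<open>The form at the test vector with entries \<open>t\<close> and
    \<open>- cnj ?b\<close>, as a quadratic in \<open>t\<close>.\<close>
  have *: "0 \<le> t\<^sup>2 * ?a - 2 * t * (norm ?b)\<^sup>2 + (norm ?b)\<^sup>2 * ?d" for t :: real
  proof -
    have "Re (cip (vector [of_real t, - cnj ?b]) (A *v (vector [of_real t, - cnj ?b]))) =
        t\<^sup>2 * ?a - 2 * t * (norm ?b)\<^sup>2 + (norm ?b)\<^sup>2 * ?d"
      unfolding cmod_power2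
      by (simp add: cip_def sum_2 matrix_vector_mult_def h r(1)[THEN arg_cong[where f=Im], simplified]
          r(2)[THEN arg_cong[where f=Im], simplified] algebra_simps power2_eq_square)
    with q show ?thesis by metis
  qed
  show "(norm ?b)\<^sup>2 \<le> ?a * ?d"
  proof (cases "?d = 0")
    case True
    have "?b = 0"
    proof (rule ccontr)
      assume "?b \<noteq> 0"
      then have n: "(norm ?b)\<^sup>2 > 0" by simp
      \<comment> \<open>With \<open>?d = 0\<close> only the quadratic and the linear term remain,
        and this small positive \<open>t\<close> makes their sum negative; the summand 1 covers
        \<open>?a = 0\<close>.\<close>
      let ?t = "(norm ?b)\<^sup>2 / (?a + 1)"
      have "?t\<^sup>2 * ?a - 2 * ?t * (norm ?b)\<^sup>2 = - ?t * (norm ?b)\<^sup>2 * ((?a + 2) / (?a + 1))"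
        using a by (simp add: divide_simps power2_eq_square) (simp add: algebra_simps)
      also have "\<dots> < 0"
        using a n by (intro mult_neg_pos) auto
      finally show False using *[of ?t] True by simp
    qed
    then show ?thesis using True by simp
  next
    case False
    then have "?d > 0" using d by simp
    \<comment> \<open>At \<open>t = ?d\<close> the quadratic factors as \<open>?d\<close> times the
      minor.\<close>
    have "0 \<le> ?d * (?a * ?d - (norm ?b)\<^sup>2)"
      using *[of ?d] by (simp add: algebra_simps power2_eq_square)
    then show ?thesis
      using \<open>?d > 0\<close> by (simp add: zero_le_mult_iff)
  qed
qed

text \<open>The hypotheses concern entries rather than \<open>psd\<close>, since
  \<open>hermitian_2_definite\<close> uses the factor to establish positivity.\<close>

lemma cholesky_2:
  fixes A :: "complex^2^2"
  assumes "A $ 1 $ 1 = of_real (Re (A $ 1 $ 1))" "A $ 2 $ 2 = of_real (Re (A $ 2 $ 2))"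
    "A $ 2 $ 1 = cnj (A $ 1 $ 2)" "0 \<le> Re (A $ 1 $ 1)" "0 \<le> Re (A $ 2 $ 2)"
    "(norm (A $ 1 $ 2))\<^sup>2 \<le> Re (A $ 1 $ 1) * Re (A $ 2 $ 2)"
  obtains k :: "complex^2^2" where "A = k ** dagger k" "k $ 1 $ 2 = 0"
proof -
  let ?a = "Re (A $ 1 $ 1)" and ?d = "Re (A $ 2 $ 2)" and ?b = "A $ 1 $ 2"
  note e = assms
  \<comment> \<open>If \<open>?a = 0\<close> then also \<open>?b = 0\<close>, and division by zero
    yields 0, so one formula covers the degenerate case too.\<close>
  define k :: "complex^2^2" where "k = vector [vector [of_real (sqrt ?a), 0],
    vector [cnj ?b / of_real (sqrt ?a), of_real (sqrt (?d - (norm ?b)\<^sup>2 / ?a))]]"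
  have k12: "k $ 1 $ 2 = 0"
    by (simp add: k_def)
  have b0: "?b = 0" if "?a = 0"
    using e(6) that by simp
  have nn: "(norm ?b)\<^sup>2 / ?a \<le> ?d"
    using e(4,5,6) by (cases "?a = 0") (auto simp: divide_simps mult.commute)
  have bb: "cnj ?b * ?b = of_real ((norm ?b)\<^sup>2)"
    unfolding complex_norm_square by (rule mult.commute)
  have sq: "complex_of_real (sqrt ?a) * complex_of_real (sqrt ?a) = of_real ?a"
    using e(4) by (simp add: of_real_mult[symmetric] del: of_real_mult)
  have sq': "complex_of_real (sqrt (?d - (norm ?b)\<^sup>2 / ?a)) * complex_of_real (sqrt (?d - (norm ?b)\<^sup>2 / ?a))
      = of_real ?d - of_real ((norm ?b)\<^sup>2 / ?a)"
    using nn by (simp add: of_real_mult[symmetric] del: of_real_mult of_real_divide of_real_diff of_real_power) simp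
  have 11: "(k ** dagger k) $ 1 $ 1 = A $ 1 $ 1"
    unfolding e(1)[symmetric] using sq e(1) by (simp add: k_def matrix_matrix_mult_def sum_2)
  have 12: "(k ** dagger k) $ 1 $ 2 = A $ 1 $ 2"
    using b0 by (cases "?a = 0") (auto simp: k_def matrix_matrix_mult_def sum_2)
  have 21: "(k ** dagger k) $ 2 $ 1 = A $ 2 $ 1"
    using b0 e(3) by (cases "?a = 0") (auto simp: k_def matrix_matrix_mult_def sum_2)
  have "(k ** dagger k) $ 2 $ 2 = cnj ?b * ?b / (of_real (sqrt ?a) * of_real (sqrt ?a))
      + (of_real ?d - of_real ((norm ?b)\<^sup>2 / ?a))"
    unfolding sq'[symmetric] by (simp add: k_def matrix_matrix_mult_def sum_2)
  also have "\<dots> = of_real ?d"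
    unfolding sq bb by simp
  finally have 22: "(k ** dagger k) $ 2 $ 2 = A $ 2 $ 2"
    using e(2) by simp
  have "A = k ** dagger k"
    using 11 12 21 22 by (simp add: vec_eq_iff forall_2)
  then show thesis
    using k12 by (rule that)
qed

lemma psd_2_cholesky:
  fixes A :: "complex^2^2"
  assumes "psd A"
  obtains k :: "complex^2^2" where "A = k ** dagger k" "k $ 1 $ 2 = 0"
  by (rule cholesky_2[OF psd_2_entries[OF assms]])

lemma psd_2_factor:
  fixes A :: "complex^2^2"
  assumes "psd A"
  obtains k :: "complex^2^2" where "A = k ** dagger k"
  by (rule psd_2_cholesky[OF assms])

text \<open>A positive determinant gives both diagonal entries the same sign, so \<open>A\<close> or
  \<open>- A\<close> meets the conditions of \<open>cholesky_2\<close>.\<close>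

lemma hermitian_2_definite:
  fixes A :: "complex^2^2"
  assumes "dagger A = A" and "0 < Re (det A)"
  shows "psd A \<or> psd (- A)"
proof -
  have h: "A $ i $ j = cnj (A $ j $ i)" for i j
    using arg_cong[OF assms(1), of "\<lambda>M. M $ i $ j"] by simp
  have r: "A $ i $ i = of_real (Re (A $ i $ i))" for i
    using h[of i i] by (simp add: complex_eq_iff)
  have "Re (det A) = Re (A $ 1 $ 1) * Re (A $ 2 $ 2) - (norm (A $ 1 $ 2))\<^sup>2"
    unfolding cmod_power2 using h[of 2 1] arg_cong[OF r[of 1], of Im] by (simp add: det_2 power2_eq_square)
  then have d: "(norm (A $ 1 $ 2))\<^sup>2 < Re (A $ 1 $ 1) * Re (A $ 2 $ 2)"
    using assms(2) by simp
  then have "0 < Re (A $ 1 $ 1) * Re (A $ 2 $ 2)"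
    by (rule le_less_trans[rotated]) simp
  then consider "0 \<le> Re (A $ 1 $ 1)" "0 \<le> Re (A $ 2 $ 2)" | "Re (A $ 1 $ 1) \<le> 0" "Re (A $ 2 $ 2) \<le> 0"
    by (auto simp: zero_less_mult_iff)
  then show ?thesis
  proof cases
    case 1
    obtain k :: "complex^2^2" where "A = k ** dagger k"
      by (rule cholesky_2[OF r r h 1 less_imp_le[OF d]])
    then show ?thesis
      using psd_congruence[OF psd_mat_1, of k] by simp
  next
    case 2
    obtain k :: "complex^2^2" where "- A = k ** dagger k"
    proof (rule cholesky_2[of "- A"])
      show "(- A) $ 1 $ 1 = of_real (Re ((- A) $ 1 $ 1))" "(- A) $ 2 $ 2 = of_real (Re ((- A) $ 2 $ 2))"
        "(- A) $ 2 $ 1 = cnj ((- A) $ 1 $ 2)"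
        using r h[of 2 1] by simp_all
      show "0 \<le> Re ((- A) $ 1 $ 1)" "0 \<le> Re ((- A) $ 2 $ 2)"
        "(norm ((- A) $ 1 $ 2))\<^sup>2 \<le> Re ((- A) $ 1 $ 1) * Re ((- A) $ 2 $ 2)"
        using d 2 by simp_all
    qed
    then show ?thesis
      using psd_congruence[OF psd_mat_1, of k] by simp
  qed
qed

text \<open>The determinant is the squared modulus of the product of the diagonal entries of the
  triangular factor \<open>k\<close>, so one of these vanishes. Then either \<open>k\<close> has a
  single nonzero column, or only the lower right entry of \<open>A\<close> can be nonzero.\<close>

lemma psd_2_rank_1:
  fixes A :: "complex^2^2"
  assumes "psd A" and "det A = 0"
  obtains n where "\<And>v. A *v v = cip n v *s n"
proof -
  obtain k :: "complex^2^2" where k: "A = k ** dagger k" "k $ 1 $ 2 = 0"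
    by (rule psd_2_cholesky[OF assms(1)])
  have "k $ 1 $ 1 = 0 \<or> k $ 2 $ 2 = 0"
    using assms(2) k(2) unfolding k(1) det_mul det_dagger by (simp add: det_2)
  then show thesis
  proof
    assume "k $ 2 $ 2 = 0"
    then have "A *v v = cip (vector [k $ 1 $ 1, k $ 2 $ 1]) v *s vector [k $ 1 $ 1, k $ 2 $ 1]" for v
      using k by (simp add: vec_eq_iff forall_2 matrix_vector_mult_def matrix_matrix_mult_def sum_2 cip_def algebra_simps)
    then show thesis by (rule that)
  next
    assume k11: "k $ 1 $ 1 = 0"
    let ?r = "(norm (k $ 2 $ 1))\<^sup>2 + (norm (k $ 2 $ 2))\<^sup>2"
    have r: "complex_of_real (sqrt ?r) * complex_of_real (sqrt ?r) = k $ 2 $ 1 * cnj (k $ 2 $ 1) + k $ 2 $ 2 * cnj (k $ 2 $ 2)"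
      unfolding complex_norm_square[symmetric] of_real_add[symmetric] of_real_mult[symmetric] by simp
    have "A *v v = cip (vector [0, of_real (sqrt ?r)]) v *s vector [0, of_real (sqrt ?r)]" for v
      using k k11 r by (simp add: vec_eq_iff forall_2 matrix_vector_mult_def matrix_matrix_mult_def sum_2 cip_def mult_ac
          del: of_real_add)
    then show thesis by (rule that)
  qed
qed

lemma psd_2_trace:
  fixes A :: "complex^2^2"
  assumes "psd A"
  shows "0 \<le> Re (trace A)" and "trace A = 0 \<Longrightarrow> A = 0"
proof -
  note e = psd_2_entries[OF assms]
  show "0 \<le> Re (trace A)"
    using e by (simp add: trace_def sum_2)
  assume "trace A = 0"
  then have "Re (A $ 1 $ 1) + Re (A $ 2 $ 2) = 0"
    by (simp add: trace_def sum_2 complex_eq_iff)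
  then have "Re (A $ 1 $ 1) = 0" "Re (A $ 2 $ 2) = 0"
    using e by auto
  then show "A = 0"
    using e by (auto simp: vec_eq_iff forall_2)
qed

text \<open>With \<open>A = k ** dagger k\<close> the trace is that of the psd matrix
  \<open>dagger k ** B ** k\<close>. If it is zero, this matrix vanishes, and an invertible
  \<open>k\<close> cancels. The second part later turns vanishing pairings into matrix
  equations.\<close>

lemma trace_mult_psd_2:
  fixes A B :: "complex^2^2"
  assumes "psd A" "psd B"
  shows "0 \<le> Re (trace (A ** B))"
    and "det A \<noteq> 0 \<Longrightarrow> Re (trace (A ** B)) = 0 \<Longrightarrow> B = 0"
proof -
  obtain k :: "complex^2^2" where k: "A = k ** dagger k"
    by (rule psd_2_factor[OF assms(1)])
  have *: "trace (A ** B) = trace (dagger k ** B ** k)"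
    unfolding k using trace_mul_sym[of k "dagger k ** B"] by (simp add: matrix_mul_assoc)
  have p: "psd (dagger k ** B ** k)"
    using psd_congruence[OF assms(2), of "dagger k"] by simp
  show "0 \<le> Re (trace (A ** B))"
    unfolding * using p by (rule psd_2_trace)
  assume dA: "det A \<noteq> 0" and t: "Re (trace (A ** B)) = 0"
  have "trace (dagger k ** B ** k) = cnj (trace (dagger k ** B ** k))"
    using trace_dagger[of "dagger k ** B ** k"] psd_dagger[OF p] by simp
  then have "trace (dagger k ** B ** k) = 0"
    using t unfolding * by (simp add: complex_eq_iff)
  then have 0: "dagger k ** B ** k = 0"
    by (rule psd_2_trace(2)[OF p])
  have dk: "det k \<noteq> 0"
    using dA k by (auto simp: det_mul)
  then have dk': "det (dagger k) \<noteq> 0"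
    by (simp add: det_dagger)
  have "B = (matrix_inv (dagger k) ** dagger k) ** B ** (k ** matrix_inv k)"
    by (simp add: matrix_inv_mult[OF dk] matrix_inv_mult[OF dk'])
  also have "\<dots> = matrix_inv (dagger k) ** (dagger k ** B ** k) ** matrix_inv k"
    by (simp add: matrix_mul_assoc)
  finally show "B = 0"
    by (simp add: 0)
qed

lemma psd_2_det: "psd (A :: complex^2^2) \<Longrightarrow> det A = of_real (Re (det A)) \<and> 0 \<le> Re (det A)"
proof -
  assume "psd A"
  then obtain k :: "complex^2^2" where "A = k ** dagger k"
    by (rule psd_2_factor)
  then have "det A = of_real ((norm (det k))\<^sup>2)"
    unfolding complex_norm_square by (simp add: det_mul det_dagger)
  then show ?thesis by simp
qed

text \<open>The adjugate of a Hermitian matrix is its entrywise conjugate, conjugated by the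
  rotation \<open>[[0, 1], [-1, 0]]\<close>; entrywise conjugation keeps the form
  \<open>k ** dagger k\<close>.\<close>

lemma psd_2_adjugate:
  fixes A :: "complex^2^2"
  assumes "psd A"
  shows "psd (vector [vector [A $ 2 $ 2, - A $ 1 $ 2], vector [- A $ 2 $ 1, A $ 1 $ 1]] :: complex^2^2)"
    (is "psd ?B")
proof -
  have "psd (\<chi> i j. cnj (A $ i $ j))"
  proof -
    obtain k :: "complex^2^2" where k: "A = k ** dagger k"
      by (rule psd_2_factor[OF assms])
    have "(\<chi> i j. cnj (A $ i $ j)) = (\<chi> i j. cnj (k $ i $ j)) ** mat 1 ** dagger (\<chi> i j. cnj (k $ i $ j))"
      by (simp add: k vec_eq_iff matrix_matrix_mult_def[of _ "dagger _"])
    then show ?thesis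
      using psd_congruence[OF psd_mat_1] by metis
  qed
  note psd_congruence[OF this, of "vector [vector [0, 1], vector [-1, 0]] :: complex^2^2"]
  moreover have "(vector [vector [0, 1], vector [-1, 0]] :: complex^2^2) ** (\<chi> i j. cnj (A $ i $ j)) **
      dagger (vector [vector [0, 1], vector [-1, 0]]) = ?B"
    using psd_2_entries(1-3)[OF assms]
    by (simp add: vec_eq_iff forall_2 matrix_matrix_mult_def sum_2 complex_eq_iff)
  ultimately show ?thesis by simp
qed

text \<open>The mixed term of \<open>det (A + B)\<close> is the trace of the adjugate of
  \<open>A\<close> times \<open>B\<close>, which is nonnegative for psd matrices.\<close>

lemma det_add_psd_2:
  fixes A B :: "complex^2^2"
  assumes "psd A" "psd B"
  shows "Re (det A) + Re (det B) \<le> Re (det (A + B))"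
proof -
  have "det (A + B) = det A + det B +
      trace (vector [vector [A $ 2 $ 2, - A $ 1 $ 2], vector [- A $ 2 $ 1, A $ 1 $ 1]] ** B)"
    by (simp add: det_2 trace_def sum_2 matrix_matrix_mult_def algebra_simps)
  with trace_mult_psd_2(1)[OF psd_2_adjugate[OF assms(1)] assms(2)] show ?thesis
    by simp
qed

text \<open>A kernel vector of the corner, padded with 0, is a null vector of the whole form and
  hence lies in the kernel of the block matrix.\<close>

lemma det_blk_psd_singular:
  assumes "psd (blk A B C D)" and "det A = 0"
  shows "det (blk A B C D) = 0"
proof -
  obtain v where v: "v \<noteq> 0" "A *v v = 0"
    using assms(2) det_zero_ker by blast
  have "blk A B C D *v vblk v 0 = 0"
    using v by (intro psd_cip_zero[OF assms(1)]) (simp add: blk_mult_vblk cip_vblk)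
  moreover have "vblk v 0 \<noteq> 0"
    using v by (metis vblk_eq_iff vblk_zero)
  ultimately show ?thesis
    using det_zero_ker by blast
qed

text \<open>Adding \<open>Q\<close> to \<open>D\<close> adds \<open>Q\<close> to the Schur
  complement of \<open>A\<close>; for singular \<open>A\<close> both determinants are 0.\<close>

lemma det_blk_psd_mono_2:
  fixes A :: "complex^2^2"
  assumes "psd (blk A B C D)" and "psd Q"
  shows "Re (det (blk A B C D)) \<le> Re (det (blk A B C (D + Q)))"
proof -
  have "blk A B C (D + Q) = blk A B C D + blk 0 0 0 Q"
    by (simp add: blk_add)
  then have p: "psd (blk A B C (D + Q))"
    using assms by (simp add: psd_add psd_blk_diagI psd_zero)
  show ?thesis
  proof (cases "det A = 0")
    case True
    then show ?thesis
      using det_blk_psd_singular[OF assms(1)] det_blk_psd_singular[OF p] by simp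
  next
    case False
    let ?S = "D - C ** matrix_inv A ** B"
    have "psd ?S" by (rule psd_schur(1)[OF assms(1) False])
    have DQ: "D + Q - C ** matrix_inv A ** B = ?S + Q" by simp
    have "Re (det ?S) \<le> Re (det (D + Q - C ** matrix_inv A ** B))"
      unfolding DQ using det_add_psd_2[OF \<open>psd ?S\<close> assms(2)] psd_2_det[OF assms(2)] by linarith
    moreover have "Re (det A * z) = Re (det A) * Re z" for z
      using psd_2_det[OF psd_blk_diag(1)[OF assms(1)]] by (metis Re_complex_of_real scaleR_conv_of_real scaleR_complex.sel(1))
    moreover have "0 \<le> Re (det A)"
      using psd_2_det[OF psd_blk_diag(1)[OF assms(1)]] by simp
    ultimately show ?thesis
      by (simp add: psd_schur(2)[OF assms(1) False] psd_schur(2)[OF p False] mult_left_mono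
          del: times_complex.sel)
  qed
qed

text \<open>One corner at a time: flipping the blocks turns the change of \<open>A\<close> into a
  change of the lower corner.\<close>

lemma det_blk_psd_mono:
  fixes A :: "complex^2^2"
  assumes "psd (blk A B C D)" and "psd P" and "psd Q"
  shows "Re (det (blk A B C D)) \<le> Re (det (blk (A + P) B C (D + Q)))"
proof -
  have "psd (blk A B C D + blk 0 0 0 Q)"
    using assms by (simp only: psd_add psd_blk_diagI psd_zero)
  then have "psd (blk (D + Q) C B A)"
    by (simp add: blk_add psd_blk_swap)
  then have "Re (det (blk (D + Q) C B A)) \<le> Re (det (blk (D + Q) C B (A + P)))"
    using assms(2) by (rule det_blk_psd_mono_2)
  with det_blk_psd_mono_2[OF assms(1,3)] show ?thesis
    by (simp add: det_blk_swap)
qed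

section \<open>The gap\<close>

definition gap :: "complex^(2 \<times> 2)^(2 \<times> 2) \<Rightarrow> real" where
  "gap \<rho> = Re (trace (ptrace_A \<rho> ** ptrace_A \<rho>)) - Re (trace (\<rho> ** \<rho>)) + 4 * sqrt (Re (det \<rho>))"

text \<open>For 2 x 2 matrices the squared trace of \<open>M\<close> minus the trace of
  \<open>M ** M\<close> is \<open>2 * det M\<close>. This identity handles the corners, and its
  polarisation handles the pair \<open>X\<close>, \<open>dagger X\<close>.\<close>

lemma gap_blk:
  assumes "dagger A = A" "dagger D = D"
  shows "gap (blk A X (dagger X) D) = 2 * Re (det A) + 2 * Re (det D)
    + 2 * (Re (det (X + dagger X)) - 2 * Re (det X)) + 4 * sqrt (Re (det (blk A X (dagger X) D)))"
proof -
  have A: "A $ i $ j = cnj (A $ j $ i)" for i j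
    using arg_cong[OF assms(1), of "\<lambda>M. M $ i $ j"] by simp
  have D: "D $ i $ j = cnj (D $ j $ i)" for i j
    using arg_cong[OF assms(2), of "\<lambda>M. M $ i $ j"] by simp
  let ?M = "blk A X (dagger X) D"
  have "trace (ptrace_A ?M ** ptrace_A ?M) - trace (?M ** ?M) =
      2 * det A + 2 * det D + 2 * (det (X + dagger X) - det X - det (dagger X))"
    unfolding blk_mult trace_blk
    by (simp add: ptrace_A_def trace_def matrix_matrix_mult_def sum_2 det_2 algebra_simps)
  then have "Re (trace (ptrace_A ?M ** ptrace_A ?M)) - Re (trace (?M ** ?M)) =
      Re (2 * det A + 2 * det D + 2 * (det (X + dagger X) - det X - det (dagger X)))"
    by (metis minus_complex.sel(1))
  then show ?thesis
    by (simp add: gap_def det_dagger)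
qed

text \<open>Congruence by \<open>g \<otimes> 1\<close>, that is by \<open>blk g 0 0 g\<close>. Each
  2 x 2 determinant is scaled by the squared modulus of \<open>det g\<close>, the 4 x 4 determinant
  by the square of that factor, which the root undoes.\<close>

lemma gap_congruence:
  assumes "dagger A = A" "dagger D = D"
  shows "gap (blk (g ** A ** dagger g) (g ** X ** dagger g) (dagger (g ** X ** dagger g)) (g ** D ** dagger g)) =
    (norm (det g))\<^sup>2 * gap (blk A X (dagger X) D)"
proof -
  let ?n = "(norm (det g))\<^sup>2"
  have d: "det (g ** M ** dagger g) = of_real ?n * det M" for M
    unfolding complex_norm_square by (simp add: det_mul det_dagger mult_ac)
  have "blk (g ** A ** dagger g) (g ** X ** dagger g) (dagger (g ** X ** dagger g)) (g ** D ** dagger g) =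
      blk g 0 0 g ** blk A X (dagger X) D ** dagger (blk g 0 0 g)"
    by (simp add: dagger_blk blk_mult dagger_mult matrix_mul_assoc)
  then have D: "det (blk (g ** A ** dagger g) (g ** X ** dagger g) (dagger (g ** X ** dagger g)) (g ** D ** dagger g)) =
      of_real (?n\<^sup>2) * det (blk A X (dagger X) D)"
    unfolding power2_eq_square[of ?n] of_real_mult complex_norm_square
    by (simp add: det_mul det_dagger det_blk_lower mult_ac)
  have h: "dagger (g ** M ** dagger g) = g ** M ** dagger g" if "dagger M = M" for M
    using that by (simp add: dagger_mult matrix_mul_assoc)
  have Re_of_real_mult: "Re (of_real r * w) = r * Re w" for r w
    by simp
  have S: "sqrt (?n\<^sup>2 * w) = ?n * sqrt w" for w
    by (simp only: real_sqrt_mult real_sqrt_abs abs_power2)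
  have X: "g ** X ** dagger g + dagger (g ** X ** dagger g) = g ** (X + dagger X) ** dagger g"
    by (simp add: dagger_mult matrix_ring_simps)
  have "gap (blk (g ** A ** dagger g) (g ** X ** dagger g) (dagger (g ** X ** dagger g)) (g ** D ** dagger g)) =
      2 * (?n * Re (det A)) + 2 * (?n * Re (det D)) + 2 * (?n * Re (det (X + dagger X)) - 2 * (?n * Re (det X)))
      + 4 * (?n * sqrt (Re (det (blk A X (dagger X) D))))"
    by (subst gap_blk) (simp_all only: h[OF assms(1)] h[OF assms(2)] X D d S Re_complex_of_real Re_of_real_mult
)
  also have "\<dots> = ?n * gap (blk A X (dagger X) D)"
    by (simp add: gap_blk assms algebra_simps)
  finally show ?thesis .
qed

text \<open>The matrix is \<open>L ** dagger L\<close> with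
  \<open>L = blk (mat 1) x (dagger y) (mat 1)\<close> and \<open>det L = z\<close>, so the root in
  the gap is \<open>norm z\<close>. The rest is a polynomial identity.\<close>

lemma gap_normal_form:
  fixes x y :: "complex^2^2"
  defines "z \<equiv> det (mat 1 - x ** dagger y)"
  shows "gap (blk (mat 1 + x ** dagger x) (x + y) (dagger (x + y)) (mat 1 + dagger y ** y)) =
    2 * (norm (det x - det y))\<^sup>2 + 2 * (norm (trace x + trace y))\<^sup>2 + 4 * (norm z + Re z)"
proof -
  have b: "blk (mat 1 + x ** dagger x) (x + y) (dagger (x + y)) (mat 1 + dagger y ** y) =
      blk (mat 1) x (dagger y) (mat 1) ** dagger (blk (mat 1) x (dagger y) (mat 1))"
    by (simp add: dagger_blk blk_mult dagger_mult algebra_simps)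
  have "det (blk (mat 1) x (dagger y) (mat 1)) = z"
    unfolding z_def det_blk_unit by (simp add: det_2 matrix_matrix_mult_def sum_2 mat_def algebra_simps)
  then have "det (blk (mat 1 + x ** dagger x) (x + y) (dagger (x + y)) (mat 1 + dagger y ** y)) = of_real ((norm z)\<^sup>2)"
    unfolding b complex_norm_square by (simp add: det_mul det_dagger)
  then have s: "sqrt (Re (det (blk (mat 1 + x ** dagger x) (x + y) (dagger (x + y)) (mat 1 + dagger y ** y)))) = norm z"
    by simp
  have "det (mat 1 + x ** dagger x) + det (mat 1 + dagger y ** y)
      + (det (x + y + dagger (x + y)) - det (x + y) - det (dagger (x + y))) =
      (det x - det y) * cnj (det x - det y) + (trace x + trace y) * cnj (trace x + trace y) + (z + cnj z)"
    unfolding z_def by (simp add: det_2 trace_def matrix_matrix_mult_def sum_2 mat_def algebra_simps)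
  then have "Re (det (mat 1 + x ** dagger x)) + Re (det (mat 1 + dagger y ** y))
      + (Re (det (x + y + dagger (x + y))) - 2 * Re (det (x + y))) =
      (norm (det x - det y))\<^sup>2 + (norm (trace x + trace y))\<^sup>2 + 2 * Re z"
    unfolding complex_norm_square[symmetric] det_dagger by (simp add: complex_eq_iff)
  then show ?thesis
    by (subst gap_blk) (simp_all add: dagger_mult s[simplified] algebra_simps)
qed

lemma gap_mono:
  assumes "psd (blk A X C D)" "psd P" "psd Q"
  shows "gap (blk A X C D) \<le> gap (blk (A + P) X C (D + Q))"
proof -
  have C: "C = dagger X" and h: "dagger A = A" "dagger D = D" "dagger P = P" "dagger Q = Q"
    using assms by (auto simp: psd_blk_iff psd_dagger)
  have "Re (det A) \<le> Re (det (A + P))"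
    using det_add_psd_2[OF psd_blk_diag(1)[OF assms(1)] assms(2)] psd_2_det[OF assms(2)] by linarith
  moreover have "Re (det D) \<le> Re (det (D + Q))"
    using det_add_psd_2[OF psd_blk_diag(2)[OF assms(1)] assms(3)] psd_2_det[OF assms(3)] by linarith
  moreover have "sqrt (Re (det (blk A X C D))) \<le> sqrt (Re (det (blk (A + P) X C (D + Q))))"
    using det_blk_psd_mono[OF assms] by simp
  moreover have "dagger (A + P) = A + P" "dagger (D + Q) = D + Q"
    by (simp_all add: h)
  ultimately show ?thesis
    unfolding C gap_blk[OF h(1,2)] by (simp only: gap_blk)
qed

text \<open>The shift raises the determinant of a corner by \<open>s\<close> times its trace plus
  the square of \<open>s\<close>; the corners together grow strictly, while the 4 x 4 determinant
  does not decrease.\<close>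

lemma gap_strict_mono:
  assumes "psd M" and "0 < Re (trace M)" and "0 < s"
  shows "gap M < gap (M + s *\<^sub>R mat 1)"
proof -
  obtain A X C D where M: "M = blk A X C D"
    by (rule blk_exhaust)
  have p: "psd (blk A X C D)" and C: "C = dagger X" and h: "dagger A = A" "dagger D = D"
    using assms(1) by (auto simp: M psd_blk_iff)
  have I: "M + s *\<^sub>R mat 1 = blk (A + s *\<^sub>R mat 1) X C (D + s *\<^sub>R mat 1)"
    by (simp add: M blk_mat_1[symmetric] blk_scaleR blk_add)
  have d: "Re (det (A + s *\<^sub>R mat 1)) = Re (det A) + s * Re (trace A) + s\<^sup>2" for A :: "complex^2^2"
    by (simp add: det_2 trace_def sum_2 mat_def algebra_simps power2_eq_square)
  have ps: "psd (s *\<^sub>R mat 1 :: complex^2^2)"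
    using assms(3) by (simp add: psd_scaleR psd_mat_1)
  let ?N = "blk (A + s *\<^sub>R mat 1) X C (D + s *\<^sub>R mat 1)"
  have 1: "sqrt (Re (det M)) \<le> sqrt (Re (det ?N))"
    using det_blk_psd_mono[OF p ps ps] by (simp add: M)
  have 2: "0 < s * (Re (trace A) + Re (trace D))" and 3: "0 < s\<^sup>2"
    using assms(2,3) by (simp_all add: M trace_blk)
  have 4: "gap M = 2 * Re (det A) + 2 * Re (det D)
    + 2 * (Re (det (X + dagger X)) - 2 * Re (det X)) + 4 * sqrt (Re (det M))"
    unfolding M C by (simp add: gap_blk h)
  have 5: "gap ?N = 2 * (Re (det A) + s * Re (trace A) + s\<^sup>2)
    + 2 * (Re (det D) + s * Re (trace D) + s\<^sup>2)
    + 2 * (Re (det (X + dagger X)) - 2 * Re (det X)) + 4 * sqrt (Re (det ?N))"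
    unfolding C d[symmetric] by (rule gap_blk) (simp_all add: h)
  have "gap ?N - gap M = 2 * (s * (Re (trace A) + Re (trace D))) + 4 * s\<^sup>2
    + 4 * (sqrt (Re (det ?N)) - sqrt (Re (det M)))"
    unfolding 4 5 by (simp add: algebra_simps)
  then have "0 < gap ?N - gap M"
    using 1 2 3 by (simp only: add_pos_nonneg add_pos_pos diff_ge_0_iff_ge zero_less_mult_iff
        mult_nonneg_nonneg zero_le_numeral zero_less_numeral simp_thms)
  then show ?thesis
    unfolding I by simp
qed

section \<open>Necessity\<close>

text \<open>Congruence by the 0-1 matrix that selects indices along \<open>f\<close>. Repeated
  indices are allowed; a constant \<open>f\<close> yields diagonal entries.\<close>

lemma psd_submatrix:
  fixes M :: "complex^'n^'n" and f :: "'m::finite \<Rightarrow> 'n"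
  assumes "psd M"
  shows "psd (\<chi> i j. M $ f i $ f j)"
proof -
  define A :: "complex^'n^'m" where "A = (\<chi> i k. if k = f i then 1 else 0)"
  have "(\<chi> i j. M $ f i $ f j) = A ** M ** dagger A"
    by (simp add: A_def vec_eq_iff matrix_matrix_mult_def if_distrib[of "\<lambda>z. z * _"] if_distrib[of cnj]
        if_distrib[of "\<lambda>z. _ * z"] cong: if_cong)
  then show ?thesis
    using psd_congruence[OF assms] by metis
qed

lemma psd_average: "psd M \<Longrightarrow> psd N \<Longrightarrow> psd ((1/2) *\<^sub>R (M + N))"
  by (simp add: psd_add psd_scaleR)

text \<open>Comparing the two marginals shows that the diagonal blocks of \<open>\<sigma>\<close> at
  \<open>(1, 2)\<close> and \<open>(2, 1)\<close> agree; this common block is \<open>m\<close>.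
  Averaging principal submatrices over the exchange of B and B' gives \<open>x\<close>, which links
  \<open>(1, 1)\<close> to \<open>m\<close>, and \<open>y\<close>, which links \<open>m\<close> to
  \<open>(2, 2)\<close>.\<close>

lemma extension_blocks:
  fixes \<sigma> :: "complex^('a::finite \<times> 2 \<times> 2)^('a \<times> 2 \<times> 2)"
  assumes "psd \<sigma>" and "ptrace_B' \<sigma> = blk A X C D" and "ptrace_B \<sigma> = blk A X C D"
  obtains m x y where "psd (blk (A - m) x (dagger x) m)" "psd (blk m y (dagger y) (D - m))" "X = x + y"
proof -
  define s where "s b c b' c' = (\<chi> a a'. \<sigma> $ (a, b, c) $ (a', b', c'))" for b c b' c'
  have e1: "(\<Sum>c\<in>UNIV. \<sigma> $ (a, b, c) $ (a', b', c)) = blk A X C D $ (a, b) $ (a', b')" for a b a' b'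
    using arg_cong[OF assms(2), of "\<lambda>M. M $ (a, b) $ (a', b')"] by (simp add: ptrace_B'_def)
  have e2: "(\<Sum>c\<in>UNIV. \<sigma> $ (a, c, b) $ (a', c, b')) = blk A X C D $ (a, b) $ (a', b')" for a b a' b'
    using arg_cong[OF assms(3), of "\<lambda>M. M $ (a, b) $ (a', b')"] by (simp add: ptrace_B_def)
  have A1: "A = s 1 1 1 1 + s 1 2 1 2" and X1: "X = s 1 1 2 1 + s 1 2 2 2" and D1: "D = s 2 1 2 1 + s 2 2 2 2"
    using e1[of _ 1 _ 1] e1[of _ 1 _ 2] e1[of _ 2 _ 2] by (simp_all add: vec_eq_iff s_def sum_2)
  have A2: "A = s 1 1 1 1 + s 2 1 2 1" and X2: "X = s 1 1 1 2 + s 2 1 2 2"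
    using e2[of _ 1 _ 1] e2[of _ 1 _ 2] by (simp_all add: vec_eq_iff s_def sum_2)
  define m where "m = s 1 2 1 2"
  define x where "x = (1/2) *\<^sub>R (s 1 1 1 2 + s 1 1 2 1)"
  define y where "y = (1/2) *\<^sub>R (s 1 2 2 2 + s 2 1 2 2)"
  have m2: "s 2 1 2 1 = m"
    using A1 A2 by (simp add: m_def)
  have p: "psd (blk (s b c b c) (s b c b' c') (dagger (s b c b' c')) (s b' c' b' c'))" for b c b' c'
  proof -
    define f where "f i = (if snd i = 1 then (fst i, b, c) else (fst i, b', c'))" for i :: "'a \<times> 2"
    have "(\<chi> i j. \<sigma> $ f i $ f j) = blk (s b c b c) (s b c b' c') (s b' c' b c) (s b' c' b' c')"
      by (simp add: vec_eq_iff_prod_2 f_def s_def)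
    moreover have "dagger (s b c b' c') = s b' c' b c"
      using arg_cong[OF psd_dagger[OF assms(1)], of "\<lambda>M. M $ (a, b', c') $ (a', b, c)" for a a']
      by (simp add: vec_eq_iff s_def)
    ultimately show ?thesis
      using psd_submatrix[OF assms(1), of f] by simp
  qed
  have half: "(1/2) *\<^sub>R (M + M) = M" for M :: "complex^'a^'a"
    by (simp add: scaleR_2[symmetric])
  have "(1/2) *\<^sub>R (blk (s 1 1 1 1) (s 1 1 1 2) (dagger (s 1 1 1 2)) m + blk (s 1 1 1 1) (s 1 1 2 1) (dagger (s 1 1 2 1)) m) =
      blk (A - m) x (dagger x) m"
    unfolding blk_add blk_scaleR half by (simp add: x_def A1 m_def)
  then have 1: "psd (blk (A - m) x (dagger x) m)"
    using psd_average[OF p[of 1 1 1 2] p[of 1 1 2 1]] by (simp add: m2 m_def[symmetric])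
  have "(1/2) *\<^sub>R (blk m (s 1 2 2 2) (dagger (s 1 2 2 2)) (s 2 2 2 2) + blk m (s 2 1 2 2) (dagger (s 2 1 2 2)) (s 2 2 2 2)) =
      blk m y (dagger y) (D - m)"
    unfolding blk_add blk_scaleR half by (simp add: y_def D1 m2)
  then have 2: "psd (blk m y (dagger y) (D - m))"
    using psd_average[OF p[of 1 2 2 2] p[of 2 1 2 2]] by (simp add: m2 m_def[symmetric])
  \<comment> \<open>The two marginals give two expressions for \<open>X\<close>, whose average is
    \<open>x + y\<close>.\<close>
  have "x + y = (1/2) *\<^sub>R (X + X)"
    by (subst (2) X1, subst X2) (simp add: x_def y_def scaleR_add_right)
  then have 3: "X = x + y"
    by (simp only: half)
  from 1 2 3 show thesis
    by (rule that)
qed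

lemma matrix_inv_mat_1: "matrix_inv (mat 1 :: 'a::field^'n^'n) = mat 1"
  using matrix_inv_mult(1)[of "mat 1 :: 'a^'n^'n"] by simp

text \<open>Congruence by the inverse of a factor of \<open>m\<close> turns \<open>m\<close> into
  the identity. Positivity of the Schur complements bounds the corners below by those of
  \<open>gap_normal_form\<close>, and \<open>gap_mono\<close> reduces the claim to a sum of
  nonnegative terms.\<close>

lemma gap_nonneg_invertible:
  assumes 1: "psd (blk (A - m) x (dagger x) m)" and 2: "psd (blk m y (dagger y) (D - m))" and "det m \<noteq> 0"
  shows "0 \<le> gap (blk A (x + y) (dagger (x + y)) D)"
proof -
  have m: "psd m"
    using 2 by (rule psd_blk_diag)
  have hA: "dagger A = A" and hD: "dagger D = D"
    using 1 2 psd_dagger[OF m] by (simp_all add: psd_blk_iff)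
  obtain k :: "complex^2^2" where k: "m = k ** dagger k"
    by (rule psd_2_factor[OF m])
  have dk: "det k \<noteq> 0"
    using assms(3) k by (auto simp: det_mul)
  define g where "g = matrix_inv k"
  have gk: "g ** k = mat 1"
    unfolding g_def by (rule matrix_inv_mult[OF dk])
  have dg: "det g \<noteq> 0"
    using arg_cong[OF gk, of det] by (auto simp: det_mul)
  define c where "c M = g ** M ** dagger g" for M
  have c_add: "c (M + N) = c M + c N" and c_diff: "c (M - N) = c M - c N" and c_dagger: "c (dagger M) = dagger (c M)" for M N
    by (simp_all add: c_def matrix_ring_simps dagger_mult)
  have cm: "c m = mat 1"
  proof -
    have "c m = (g ** k) ** dagger (g ** k)"
      by (simp add: c_def k dagger_mult matrix_mul_assoc)
    then show ?thesis by (simp add: gk)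
  qed
  have cong: "psd (blk (c P) (c Q) (c R) (c S))" if "psd (blk P Q R S)" for P Q R S
    using psd_congruence[OF that, of "blk g 0 0 g"] by (simp add: dagger_blk blk_mult c_def)
  \<comment> \<open>The swap moves the identity block to the upper left, where
    \<open>psd_schur\<close> eliminates it.\<close>
  have "psd (blk (mat 1) (dagger (c x)) (c x) (c A - mat 1))"
    using psd_blk_swap[OF cong[OF 1]] by (simp add: c_diff cm c_dagger)
  then have P: "psd (c A - mat 1 - c x ** dagger (c x))"
    using psd_schur(1)[of "mat 1" "dagger (c x)" "c x" "c A - mat 1"] by (simp add: matrix_inv_mat_1)
  have "psd (blk (mat 1) (c y) (dagger (c y)) (c D - mat 1))"
    using cong[OF 2] by (simp add: c_diff cm c_dagger)
  then have Q: "psd (c D - mat 1 - dagger (c y) ** c y)"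
    using psd_schur(1)[of "mat 1" "c y" "dagger (c y)" "c D - mat 1"] by (simp add: matrix_inv_mat_1)
  let ?N = "blk (mat 1 + c x ** dagger (c x)) (c x + c y) (dagger (c x + c y)) (mat 1 + dagger (c y) ** c y)"
  let ?L = "blk (mat 1) (c x) (dagger (c y)) (mat 1)"
  have "?N = ?L ** mat 1 ** dagger ?L"
    by (simp add: dagger_blk blk_mult dagger_mult algebra_simps)
  then have "psd ?N"
    using psd_congruence[OF psd_mat_1] by metis
  then have "gap ?N \<le> gap (blk (mat 1 + c x ** dagger (c x) + (c A - mat 1 - c x ** dagger (c x))) (c x + c y)
      (dagger (c x + c y)) (mat 1 + dagger (c y) ** c y + (c D - mat 1 - dagger (c y) ** c y)))"
    using P Q by (rule gap_mono)
  also have "\<dots> = gap (blk (c A) (c (x + y)) (dagger (c (x + y))) (c D))"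
    by (simp add: c_add)
  also have "\<dots> = (norm (det g))\<^sup>2 * gap (blk A (x + y) (dagger (x + y)) D)"
    unfolding c_def by (rule gap_congruence[OF hA hD])
  finally have "gap ?N \<le> (norm (det g))\<^sup>2 * gap (blk A (x + y) (dagger (x + y)) D)" .
  moreover have "0 \<le> gap ?N"
  proof -
    have "- Re w \<le> norm w" for w
      using complex_Re_le_cmod[of "- w"] by simp
    then have "0 \<le> norm w + Re w" for w
      by (metis add.commute neg_le_iff_le diff_ge_0_iff_ge diff_minus_eq_add minus_minus)
    then have z: "0 \<le> 4 * (norm w + Re w)" for w
      by (rule mult_nonneg_nonneg[rotated]) simp
    then show ?thesis
      unfolding gap_normal_form by (intro add_nonneg_nonneg z) simp_all
  qed
  ultimately show ?thesis
    using dg by (simp add: zero_le_mult_iff order_trans[of 0 "gap ?N"])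
      (meson order_trans zero_le_mult_iff zero_less_norm_iff zero_less_power not_less dg)
qed

lemma tendsto_gap:
  assumes "(f \<longlongrightarrow> M) F"
  shows "((\<lambda>x. gap (f x)) \<longlongrightarrow> gap M) F"
  unfolding gap_def ptrace_A_def trace_def matrix_matrix_mult_def det_def vec_lambda_beta
  by (intro tendsto_intros assms)

text \<open>Adding \<open>2 * e\<close> to \<open>A\<close> and \<open>D\<close> and
  \<open>e\<close> to \<open>m\<close> adds \<open>e\<close> to all four diagonal corners in the
  hypotheses and makes \<open>m\<close> invertible. The limit \<open>e\<close> to 0 uses continuity
  of \<open>gap\<close>.\<close>

lemma gap_nonneg:
  assumes 1: "psd (blk (A - m) x (dagger x) m)" and 2: "psd (blk m y (dagger y) (D - m))"
  shows "0 \<le> gap (blk A (x + y) (dagger (x + y)) D)"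
proof -
  let ?M = "blk A (x + y) (dagger (x + y)) D"
  have m: "psd m"
    using 2 by (rule psd_blk_diag)
  have nn: "0 \<le> gap (?M + (2 * e) *\<^sub>R mat 1)" if "0 < e" for e :: real
  proof -
    let ?e = "e *\<^sub>R mat 1 :: complex^2^2"
    have "psd ?e"
      using that by (simp add: psd_scaleR psd_mat_1)
    then have e: "psd (blk ?e 0 0 ?e)"
      by (simp add: psd_blk_diagI)
    have A: "A + (2 * e) *\<^sub>R mat 1 - (m + ?e) = A - m + ?e" and D: "D + (2 * e) *\<^sub>R mat 1 - (m + ?e) = D - m + ?e"
      by (simp_all only: mult_2 scaleR_add_left) simp_all
    have 1: "psd (blk (A + (2 * e) *\<^sub>R mat 1 - (m + ?e)) x (dagger x) (m + ?e))"
      unfolding A using psd_add[OF 1 e] by (simp add: blk_add)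
    have 2: "psd (blk (m + ?e) y (dagger y) (D + (2 * e) *\<^sub>R mat 1 - (m + ?e)))"
      unfolding D using psd_add[OF 2 e] by (simp add: blk_add)
    have "Re (det (m + ?e)) = Re (det m) + e * Re (trace m) + e\<^sup>2"
      by (simp add: det_2 trace_def sum_2 mat_def algebra_simps power2_eq_square)
    moreover have "0 \<le> e * Re (trace m)"
      using that psd_2_trace(1)[OF m] by simp
    moreover have "0 < e\<^sup>2"
      using that by simp
    ultimately have "0 < Re (det (m + ?e))"
      using psd_2_det[OF m] by linarith
    then have "det (m + ?e) \<noteq> 0"
      by auto
    from gap_nonneg_invertible[OF 1 2 this] show ?thesis
      by (simp add: blk_mat_1[symmetric] blk_scaleR blk_add)
  qed
  have "((\<lambda>e. gap (?M + (2 * e) *\<^sub>R mat 1)) \<longlongrightarrow> gap (?M + (2 * 0) *\<^sub>R mat 1)) (at_right 0)"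
    by (intro tendsto_gap tendsto_intros)
  moreover have "\<forall>\<^sub>F e in at_right (0::real). 0 \<le> gap (?M + (2 * e) *\<^sub>R mat 1)"
    by (rule eventually_mono[OF eventually_at_right_less]) (rule nn)
  ultimately have "0 \<le> gap (?M + (2 * 0) *\<^sub>R mat 1)"
    by (rule tendsto_lowerbound) simp
  then show ?thesis by simp
qed

section \<open>Complementary slackness\<close>

text \<open>The expectation of \<open>[[L1, G], [G\<^sup>*, L2]]\<close> in the marginal of the vector of \<open>ABB'\<close> with component
  \<open>w1\<close> at \<open>00\<close>, \<open>w2\<close> at both \<open>01\<close> and \<open>10\<close>, and \<open>w3\<close> at \<open>11\<close>.\<close>

definition dual_form :: "complex^'a^'a \<Rightarrow> complex^'a^'a \<Rightarrow> complex^'a^'a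
    \<Rightarrow> complex^'a \<Rightarrow> complex^'a \<Rightarrow> complex^'a::finite \<Rightarrow> real" where
  "dual_form L1 G L2 w1 w2 w3 = Re (cip w1 (L1 *v w1)) + Re (cip w2 ((L1 + L2) *v w2))
    + Re (cip w3 (L2 *v w3)) + 2 * Re (cip w1 (G *v w2)) + 2 * Re (cip w2 (G *v w3))"

lemma linear_bounded_below_zero:
  fixes p K :: real
  assumes "\<And>t. 0 \<le> t * p + K"
  shows "p = 0"
proof (rule ccontr)
  assume "p \<noteq> 0"
  with assms[of "- (K + 1) / p"] show False
    by simp
qed

text \<open>\<open>L1\<close> has rank at most one, with range spanned by \<open>n\<close>.
  Nonnegativity along the kernel of \<open>L1\<close> forces the range of \<open>G\<close> into the
  span of \<open>n\<close>, and then suitable multiples of \<open>u\<close> and \<open>v\<close>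
  turn the dual form into the block form. This will exclude singular corners of an optimal dual
  element.\<close>

lemma dual_form_singular:
  fixes L1 :: "complex^2^2"
  assumes dual: "\<And>w1 w2 w3. 0 \<le> dual_form L1 G L2 w1 w2 w3"
    and L1: "psd L1" "det L1 = 0" and L2: "psd L2"
  shows "psd (blk L1 G (dagger G) L2)"
proof -
  obtain n where n: "\<And>v. L1 *v v = cip n v *s n"
    using psd_2_rank_1[OF L1] by blast
  \<comment> \<open>For \<open>a\<close> in the kernel of \<open>L1\<close> the dual form at a
    multiple of \<open>a\<close> proportional to \<open>t\<close>, \<open>v\<close> and 0 is affine
    in \<open>t\<close>, so its slope vanishes.\<close>
  have Re0: "Re (cip a (G *v v)) = 0" if "cip n a = 0" for a v
  proof (rule linear_bounded_below_zero)
    fix t :: real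
    have "L1 *v (of_real (t / 2) *s a) = 0"
      using that by (simp add: n cip_smult_right)
    then show "0 \<le> t * Re (cip a (G *v v)) + Re (cip v ((L1 + L2) *v v))"
      using dual[of "of_real (t / 2) *s a" v 0] by (simp add: dual_form_def cip_smult_left)
  qed
  \<comment> \<open>Replacing \<open>v\<close> by \<open>\<i> *s v\<close> handles the imaginary
    part.\<close>
  have G0: "cip a (G *v v) = 0" if "cip n a = 0" for a v
    using Re0[OF that, of v] Re0[OF that, of "\<i> *s v"]
    by (simp add: complex_eq_iff matrix_vector_smult cip_smult_right)
  have "0 \<le> Re (cip u (L1 *v u)) + 2 * Re (cip u (G *v v)) + Re (cip v (L2 *v v))" for u v
  proof -
    define \<kappa> where "\<kappa> = cip n u"
    define \<nu> where "\<nu> = cip n v"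
    have nL: "cip a (L1 *v a) = of_real ((norm (cip n a))\<^sup>2)" for a
      unfolding complex_norm_square by (simp add: n cip_smult_right cip_commute[of a n])
    show ?thesis
    proof (cases "\<kappa> = 0")
      case True
      then show ?thesis
        using G0[of u v] psd_cip[OF L2, of v] by (simp add: nL \<kappa>_def)
    next
      case False
      let ?V = "Re (cip v (L2 *v v))" and ?c = "cip u (G *v v)"
      \<comment> \<open>The combination of \<open>v\<close> and \<open>u\<close> orthogonal to
        \<open>n\<close>; applying \<open>G0\<close> to it expresses \<open>cip v (G *v v)\<close>
        through \<open>?c\<close>.\<close>
      have "cip n (v - (\<nu> / \<kappa>) *s u) = 0"
        using False by (simp add: cip_diff_right cip_smult_right \<kappa>_def \<nu>_def)
      then have "cip (v - (\<nu> / \<kappa>) *s u) (G *v v) = 0"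
        by (rule G0)
      then have vG: "cip v (G *v v) = cnj (\<nu> / \<kappa>) * ?c"
        by (simp add: cip_diff_left cip_smult_left)
      let ?r = "(norm \<kappa>)\<^sup>2 + (norm \<nu>)\<^sup>2"
      have cc: "cip (\<kappa> *s u) (G *v (\<kappa> *s v)) = of_real ((norm \<kappa>)\<^sup>2) * ?c"
        unfolding complex_norm_square by (simp add: matrix_vector_smult cip_smult_left cip_smult_right)
      have cc': "cip (\<kappa> *s v) (G *v (\<nu> *s v)) = of_real ((norm \<nu>)\<^sup>2) * ?c"
        unfolding complex_norm_square using False
        by (simp add: matrix_vector_smult cip_smult_left cip_smult_right vG)
      have vv: "cip (c *s v) (M *v (c *s v)) = of_real ((norm c)\<^sup>2) * cip v (M *v v)" for c M
        unfolding complex_norm_square by (simp add: matrix_vector_smult cip_smult_left cip_smult_right)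
      \<comment> \<open>Since \<open>L1 = n n\<^sup>*\<close> and \<open>G\<close> has range in the span of \<open>n\<close>, these vectors make
        the dual form a positive multiple of the form of the block matrix at \<open>(u, v)\<close>.\<close>
      have "dual_form L1 G L2 (\<kappa> *s u) (\<kappa> *s v) (\<nu> *s v) = ?r * ((norm \<kappa>)\<^sup>2 + 2 * Re ?c + ?V)"
        unfolding dual_form_def matrix_vector_mult_add_rdistrib cip_add_right cc cc' vv nL
        by (simp add: cip_smult_right \<kappa>_def[symmetric] \<nu>_def[symmetric] norm_mult power_mult_distrib algebra_simps power2_eq_square)
      then have "0 \<le> ?r * ((norm \<kappa>)\<^sup>2 + 2 * Re ?c + ?V)"
        using dual by metis
      moreover have "0 < ?r"
        using False by (simp add: add_pos_nonneg)
      ultimately show ?thesis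
        by (simp add: zero_le_mult_iff nL \<kappa>_def)
    qed
  qed
  then show ?thesis
    using L1 L2 by (simp add: psd_blk_iff psd_dagger)
qed

text \<open>Symmetry under relabelling the basis of B, which transfers
  \<open>dual_form_singular\<close> to the other corner.\<close>

lemma dual_form_swap: "dual_form L1 G L2 w1 w2 w3 = dual_form L2 (dagger G) L1 w3 w2 w1"
  using cip_commute[of "G *v w2" w1] cip_commute[of "G *v w3" w2]
  by (simp add: dual_form_def cip_matrix[of _ "dagger G"] add.commute)

lemma dual_form_singular_either:
  fixes L1 :: "complex^2^2"
  assumes "\<And>w1 w2 w3. 0 \<le> dual_form L1 G L2 w1 w2 w3" and "psd L1" "psd L2" and "det L1 = 0 \<or> det L2 = 0"
  shows "psd (blk L1 G (dagger G) L2)"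
  using assms(4)
proof
  assume "det L1 = 0"
  then show ?thesis
    using assms by (intro dual_form_singular)
next
  assume "det L2 = 0"
  then have "psd (blk L2 (dagger G) (dagger (dagger G)) L1)"
    using assms dual_form_swap[of L1 G L2] by (intro dual_form_singular) auto
  then show ?thesis
    by (simp add: psd_blk_swap)
qed

lemma matrix_eq_zeroI: "(\<And>u. M *v u = 0) \<Longrightarrow> M = (0 :: complex^'n^'m)"
  by (simp add: matrix_eq)

text \<open>Completing squares writes the vanishing pairing as
  \<open>trace (L1 ** T1) + trace (L2 ** T2) + trace (m ** \<Psi>)\<close> with psd factors
  throughout. Hence each summand is 0, which forces \<open>T1\<close>, \<open>T2\<close> and
  \<open>\<Psi>\<close> to vanish.\<close>

lemma complementary_slackness:
  fixes L1 L2 \<Gamma> :: "complex^2^2"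
  assumes dual: "\<And>w1 w2 w3. 0 \<le> dual_form L1 \<Gamma> L2 w1 w2 w3"
    and L1: "psd L1" "det L1 \<noteq> 0" and L2: "psd L2" "det L2 \<noteq> 0"
    and 1: "psd (blk (A - m) x (dagger x) m)" and 2: "psd (blk m y (dagger y) (D - m))"
    and tr: "Re (trace (blk L1 \<Gamma> (dagger \<Gamma>) L2 ** blk A (x + y) (dagger (x + y)) D)) = 0"
    and det: "det (blk A (x + y) (dagger (x + y)) D) \<noteq> 0"
  obtains G F where "L1 ** G = dagger F ** L2" "L1 + L2 = dagger G ** L1 ** G + dagger F ** L2 ** F"
    "A = m + G ** m ** dagger G" "D = m + F ** m ** dagger F" "x + y = G ** m + m ** dagger F"
    "det (mat 1 - F ** G) \<noteq> 0" "psd m" "det m \<noteq> 0"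
proof -
  \<comment> \<open>For \<open>w2 = w\<close> the dual form is minimised over \<open>w1\<close> and
    \<open>w3\<close> at \<open>G *v w\<close> and \<open>F *v w\<close>.\<close>
  define G where "G = - (matrix_inv L1 ** \<Gamma>)"
  define F where "F = - (matrix_inv L2 ** dagger \<Gamma>)"
  note h = psd_dagger[OF L1(1)] psd_dagger[OF L2(1)]
  have L1G: "L1 ** G = - \<Gamma>" and L2F: "L2 ** F = - dagger \<Gamma>"
    using matrix_inv_mult[OF L1(2)] matrix_inv_mult[OF L2(2)]
    by (simp_all add: G_def F_def matrix_minus_right matrix_mul_assoc)
  have GL1: "dagger G ** L1 = - dagger \<Gamma>" and FL2: "dagger F ** L2 = - \<Gamma>"
    using arg_cong[OF L1G, of dagger] arg_cong[OF L2F, of dagger] by (simp_all add: dagger_mult h)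
  have m: "psd m"
    using 2 by (rule psd_blk_diag)
  \<comment> \<open>\<open>\<Psi>\<close> represents this partial minimum, so it inherits
    nonnegativity from the dual form.\<close>
  define \<Psi> where "\<Psi> = L1 + L2 - dagger G ** L1 ** G - dagger F ** L2 ** F"
  have "0 \<le> Re (cip w (\<Psi> *v w))" for w
  proof -
    have a: "cip (M *v w) (N *v v) = cip w ((dagger M ** N) *v v)" for M N :: "complex^2^2" and v
      by (simp add: cip_matrix[of w "dagger M ** N"] cip_matrix[of "M *v w" N] dagger_mult matrix_vector_mul_assoc)
    have "Re (cip w ((dagger G ** \<Gamma>) *v w)) = - Re (cip w ((dagger G ** L1 ** G) *v w))"
      unfolding matrix_mul_assoc[symmetric] L1G by (simp add: matrix_minus_right matrix_vector_mult_def cip_def sum_negf)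
    moreover have "Re (cip w ((\<Gamma> ** F) *v w)) = - Re (cip w ((dagger F ** L2 ** F) *v w))"
      unfolding FL2 by (simp add: matrix_minus_left matrix_vector_mult_def cip_def sum_negf)
    ultimately have "dual_form L1 \<Gamma> L2 (G *v w) w (F *v w) = Re (cip w (\<Psi> *v w))"
      by (simp add: dual_form_def matrix_vector_mul_assoc a \<Psi>_def matrix_vector_mult_diff_rdistrib
          matrix_vector_mult_add_rdistrib cip_diff_right cip_add_right matrix_mul_assoc)
    then show ?thesis
      using dual by metis
  qed
  then have \<Psi>: "psd \<Psi>"
    by (simp add: psd_iff \<Psi>_def dagger_mult h matrix_mul_assoc)
  \<comment> \<open>\<open>T1\<close> and \<open>T2\<close> represent the forms of the two extension
    blocks on the vectors \<open>vblk u (- (dagger G *v u))\<close> and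
    \<open>vblk (- (dagger F *v u)) u\<close>.\<close>
  define T1 where "T1 = A - m - G ** dagger x - x ** dagger G + G ** m ** dagger G"
  define T2 where "T2 = D - m - F ** y - dagger y ** dagger F + F ** m ** dagger F"
  let ?J1 = "blk (mat 1) (- G) 0 0" and ?J2 = "blk 0 0 (- F) (mat 1)"
  have J1: "?J1 ** blk (A - m) x (dagger x) m ** dagger ?J1 = blk T1 0 0 0"
    by (simp add: dagger_blk blk_mult T1_def matrix_ring_simps blk_eq_iff)
  have T1: "psd T1"
    using J1 psd_congruence[OF 1, of ?J1] psd_blk_diag(1) by metis
  have J2: "?J2 ** blk m y (dagger y) (D - m) ** dagger ?J2 = blk 0 0 0 T2"
    by (simp add: dagger_blk blk_mult T2_def matrix_ring_simps blk_eq_iff)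
  have T2: "psd T2"
    using J2 psd_congruence[OF 2, of ?J2] psd_blk_diag(2) by metis
  have "trace (blk L1 \<Gamma> (dagger \<Gamma>) L2 ** blk A (x + y) (dagger (x + y)) D) =
      trace (L1 ** T1) + trace (L2 ** T2) + trace (m ** \<Psi>)"
  proof -
    have tm: "trace (- M) = - trace M" for M :: "complex^2^2"
      by (simp add: trace_def sum_negf)
    have "trace (L1 ** G ** dagger x) = - trace (\<Gamma> ** dagger x)"
      by (simp add: L1G matrix_minus_left tm)
    moreover have "trace (L1 ** x ** dagger G) = - trace (dagger \<Gamma> ** x)"
      using trace_mul_sym[of "L1 ** x" "dagger G"] by (simp add: matrix_mul_assoc GL1 matrix_minus_left tm)
    moreover have "trace (L1 ** G ** m ** dagger G) = trace (m ** dagger G ** L1 ** G)"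
      using trace_mul_sym[of "L1 ** G" "m ** dagger G"] by (simp add: matrix_mul_assoc)
    moreover have "trace (L2 ** F ** y) = - trace (dagger \<Gamma> ** y)"
      by (simp add: L2F matrix_minus_left tm)
    moreover have "trace (L2 ** dagger y ** dagger F) = - trace (\<Gamma> ** dagger y)"
      using trace_mul_sym[of "L2 ** dagger y" "dagger F"] by (simp add: matrix_mul_assoc FL2 matrix_minus_left tm)
    moreover have "trace (L2 ** F ** m ** dagger F) = trace (m ** dagger F ** L2 ** F)"
      using trace_mul_sym[of "L2 ** F" "m ** dagger F"] by (simp add: matrix_mul_assoc)
    ultimately show ?thesis
      unfolding blk_mult trace_blk T1_def T2_def \<Psi>_def
      by (simp only: matrix_ring_simps trace_add trace_sub dagger_add trace_mul_sym[of m L1] trace_mul_sym[of m L2])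
         simp
  qed
  then have "Re (trace (L1 ** T1)) + Re (trace (L2 ** T2)) + Re (trace (m ** \<Psi>)) = 0"
    using tr by simp
  then have z: "Re (trace (L1 ** T1)) = 0" "Re (trace (L2 ** T2)) = 0" "Re (trace (m ** \<Psi>)) = 0"
    using trace_mult_psd_2(1)[OF L1(1) T1] trace_mult_psd_2(1)[OF L2(1) T2] trace_mult_psd_2(1)[OF m \<Psi>] by linarith+
  have T10: "T1 = 0"
    by (rule trace_mult_psd_2(2)[OF L1(1) T1 L1(2) z(1)])
  have T20: "T2 = 0"
    by (rule trace_mult_psd_2(2)[OF L2(1) T2 L2(2) z(2)])
  \<comment> \<open>Since \<open>T1\<close> and \<open>T2\<close> vanish, those vectors lie in the
    kernels of the extension blocks; this determines \<open>x\<close>, \<open>y\<close>,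
    \<open>A\<close> and \<open>D\<close> from \<open>m\<close>, \<open>G\<close> and
    \<open>F\<close>.\<close>
  have cj: "cip (dagger J *v w) (S *v (dagger J *v w)) = cip w ((J ** S ** dagger J) *v w)"
    for J S :: "complex^(2 \<times> 2)^(2 \<times> 2)" and w
    using cip_matrix[of w J "S *v (dagger J *v w)"] by (simp add: matrix_vector_mul_assoc matrix_mul_assoc)
  have "blk (A - m) x (dagger x) m *v (dagger ?J1 *v vblk u 0) = 0" for u
    by (rule psd_cip_zero[OF 1]) (simp add: cj J1 T10 blk_mult_vblk vblk_zero)
  then have "blk (A - m) x (dagger x) m ** dagger ?J1 *v vblk u 0 = 0" for u
    by (simp only: matrix_vector_mul_assoc)
  then have "(A - m - x ** dagger G) *v u = 0 \<and> (dagger x - m ** dagger G) *v u = 0" for u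
    by (simp add: dagger_blk blk_mult blk_mult_vblk vblk_zero[symmetric] vblk_eq_iff matrix_minus_right)
  then have "A - m - x ** dagger G = 0" "dagger x - m ** dagger G = 0"
    by (blast intro: matrix_eq_zeroI)+
  then have Am: "A = m + x ** dagger G" and xd: "dagger x = m ** dagger G"
    by (simp_all add: algebra_simps)
  have x: "x = G ** m"
    using arg_cong[OF xd, of dagger] psd_dagger[OF m] by (simp add: dagger_mult)
  have "blk m y (dagger y) (D - m) *v (dagger ?J2 *v vblk 0 u) = 0" for u
    by (rule psd_cip_zero[OF 2]) (simp add: cj J2 T20 blk_mult_vblk vblk_zero)
  then have "blk m y (dagger y) (D - m) ** dagger ?J2 *v vblk 0 u = 0" for u
    by (simp only: matrix_vector_mul_assoc)
  then have "(y - m ** dagger F) *v u = 0 \<and> (D - m - dagger y ** dagger F) *v u = 0" for u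
    by (simp add: dagger_blk blk_mult blk_mult_vblk vblk_zero[symmetric] vblk_eq_iff matrix_minus_right)
  then have "y - m ** dagger F = 0" "D - m - dagger y ** dagger F = 0"
    by (blast intro: matrix_eq_zeroI)+
  then have Dm: "D = m + dagger y ** dagger F" and y: "y = m ** dagger F"
    by (simp_all add: algebra_simps)
  have A: "A = m + G ** m ** dagger G"
    using Am x by simp
  have D: "D = m + F ** m ** dagger F"
    using Dm y psd_dagger[OF m] by (simp add: dagger_mult)
  \<comment> \<open>The block matrix is the congruence of \<open>blk m 0 0 m\<close> by
    \<open>?L\<close>, so its nonzero determinant makes both \<open>m\<close> and
    \<open>mat 1 - F ** G\<close> invertible.\<close>
  let ?L = "blk (mat 1) G F (mat 1)"
  have "blk A (x + y) (dagger (x + y)) D = ?L ** blk m 0 0 m ** dagger ?L"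
    using psd_dagger[OF m] by (simp add: dagger_blk blk_mult A D x y dagger_mult add.commute)
  then have d: "det m \<noteq> 0" "det (mat 1 - F ** G) \<noteq> 0"
    using det by (auto simp: det_mul det_blk_unit det_blk_lower)
  \<comment> \<open>Only now is \<open>m\<close> known to be invertible, as the strict part of
    \<open>trace_mult_psd_2\<close> requires.\<close>
  have "\<Psi> = 0"
    by (rule trace_mult_psd_2(2)[OF m \<Psi> d(1) z(3)])
  then have "L1 + L2 = dagger G ** L1 ** G + dagger F ** L2 ** F"
    by (simp add: \<Psi>_def algebra_simps)
  moreover have "L1 ** G = dagger F ** L2"
    by (simp add: L1G FL2)
  ultimately show thesis
    using A D x y d m by (intro that) auto
qed

text \<open>The diagonal entries are nonnegative with sum 0, so every basis vector is a null vector
  of the form and lies in the kernel.\<close>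

lemma psd_trace_zero:
  assumes "psd M" and "Re (trace M) = 0"
  shows "M = 0"
proof -
  have e: "cip (axis i 1) (M *v axis i 1) = M $ i $ i" for i
    by (simp add: cip_def matrix_vector_mult_def axis_def if_distrib[of cnj] if_distrib[of "\<lambda>z. z * _"]
        if_distrib[of "\<lambda>z. _ * z"] cong: if_cong)
  have nn: "0 \<le> Re (M $ i $ i)" for i
    using psd_cip[OF assms(1), of "axis i 1"] by (simp add: e)
  have "Re (M $ i $ i) = 0" for i
    using assms(2) nn sum_nonneg_eq_0_iff[of UNIV "\<lambda>i. Re (M $ i $ i)"] by (simp add: trace_def)
  then have 0: "M *v axis i 1 = 0" for i
    by (intro psd_cip_zero[OF assms(1)]) (simp add: e)
  have "M $ i $ j = (M *v axis j 1) $ i" for i j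
    by (simp add: matrix_vector_mult_def axis_def if_distrib[of "\<lambda>z. _ * z"] cong: if_cong)
  with 0 show ?thesis
    by (simp add: vec_eq_iff)
qed

text \<open>Block Cholesky: elimination combined with 2 x 2 factors of \<open>A\<close> and of its
  Schur complement.\<close>

lemma psd_blk_factor:
  fixes A :: "complex^2^2"
  assumes "psd (blk A B C D)" and "det (blk A B C D) \<noteq> 0"
  obtains M where "blk A B C D = M ** dagger M" "det M \<noteq> 0"
proof -
  have d: "det A \<noteq> 0"
    using det_blk_psd_singular[OF assms(1)] assms(2) by blast
  have C: "C = dagger B" and A: "dagger A = A"
    using assms(1) by (auto simp: psd_blk_iff)
  let ?I = "matrix_inv A"
  have I: "dagger ?I = ?I"
    using dagger_matrix_inv[OF d] A by simp
  have AI: "M ** ?I ** A = M" "A ** ?I = mat 1" for M :: "complex^2^2"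
    using matrix_inv_mult[OF d] by (simp_all add: matrix_mul_assoc[symmetric])
  let ?S = "D - C ** ?I ** B"
  obtain k :: "complex^2^2" where k: "A = k ** dagger k"
    by (rule psd_2_factor[OF psd_blk_diag(1)[OF assms(1)]])
  obtain l :: "complex^2^2" where l: "?S = l ** dagger l"
    by (rule psd_2_factor[OF psd_schur(1)[OF assms(1) d]])
  let ?L = "blk (mat 1) 0 (C ** ?I) (mat 1)"
  have "?L ** blk k 0 0 l ** dagger (?L ** blk k 0 0 l) = ?L ** blk (k ** dagger k) 0 0 (l ** dagger l) ** dagger ?L"
    by (simp add: dagger_blk blk_mult dagger_mult matrix_mul_assoc)
  also have "\<dots> = ?L ** blk A 0 0 ?S ** dagger ?L"
    by (simp only: k[symmetric] l[symmetric])
  also have "\<dots> = blk A B C D"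
    by (simp add: dagger_blk blk_mult dagger_mult AI C I matrix_mul_assoc)
  finally have M: "blk A B C D = ?L ** blk k 0 0 l ** dagger (?L ** blk k 0 0 l)" ..
  then have "det (?L ** blk k 0 0 l) \<noteq> 0"
    using assms(2) by (auto simp: det_mul)
  with M show thesis by (rule that)
qed

text \<open>The 4 x 4 counterpart of the strict part of \<open>trace_mult_psd_2\<close>, with the
  invertible factor supplied by \<open>psd_blk_factor\<close>.\<close>

lemma psd_blk_trace_mult_zero:
  fixes A :: "complex^2^2"
  assumes "psd H" "psd (blk A B C D)" "det (blk A B C D) \<noteq> 0" and "Re (trace (H ** blk A B C D)) = 0"
  shows "H = 0"
proof -
  obtain M where M: "blk A B C D = M ** dagger M" "det M \<noteq> 0"
    by (rule psd_blk_factor[OF assms(2,3)])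
  have "det (dagger M) \<noteq> 0"
    using M by (simp add: det_dagger)
  note i = matrix_inv_mult[OF M(2)] matrix_inv_mult[OF this]
  have "trace (H ** blk A B C D) = trace (dagger M ** H ** M)"
    unfolding M using trace_mul_sym[of "H ** M" "dagger M"] by (simp add: matrix_mul_assoc)
  moreover have "psd (dagger M ** H ** M)"
    using psd_congruence[OF assms(1), of "dagger M"] by simp
  ultimately have 0: "dagger M ** H ** M = 0"
    using assms(4) by (intro psd_trace_zero) simp_all
  have "H = matrix_inv (dagger M) ** (dagger M ** H ** M) ** matrix_inv M"
    by (simp add: matrix_mul_assoc i) (simp add: matrix_mul_assoc[symmetric] i)
  then show ?thesis
    by (simp add: 0)
qed

lemma det_minus_2: "det (- M) = det (M :: complex^2^2)"
  by (simp add: det_2)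

lemma det_mat_1_minus_commute: "det (mat 1 - M ** N) = det (mat 1 - N ** (M :: complex^2^2))"
  using det_blk_swap[of "mat 1" N M "mat 1"] by (simp add: det_blk_unit)

text \<open>The Hermitian matrix \<open>K\<close> equals \<open>L1 ** (mat 1 - G ** F)\<close> by
  \<open>sim\<close>, and \<open>- (L2 ** (mat 1 - F ** G))\<close> by \<open>sim\<close>,
  \<open>sum\<close> and Hermiticity; both right factors have determinant \<open>w\<close>. The
  conclusions make all terms of \<open>gap_normal_form\<close> vanish.\<close>

lemma factorisation_invariants:
  fixes G F L1 L2 :: "complex^2^2"
  assumes L1: "psd L1" "det L1 \<noteq> 0" and L2: "psd L2" "det L2 \<noteq> 0"
    and sim: "L1 ** G = dagger F ** L2" and sum: "L1 + L2 = dagger G ** L1 ** G + dagger F ** L2 ** F"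
    and nz: "det (mat 1 - F ** G) \<noteq> 0"
  shows "det G = cnj (det F)" "trace G = - cnj (trace F)"
    "norm (det (mat 1 - G ** F)) + Re (det (mat 1 - G ** F)) = 0"
proof -
  note h = psd_dagger[OF L1(1)] psd_dagger[OF L2(1)]
  define w where "w = det (mat 1 - G ** F)"
  have w': "det (mat 1 - F ** G) = w"
    unfolding w_def by (rule det_mat_1_minus_commute)
  define K where "K = L1 - dagger F ** L2 ** F"
  have K1: "K = L1 ** (mat 1 - G ** F)"
    by (simp add: K_def matrix_ring_simps sim)
  have GLG: "dagger G ** L1 ** G = dagger G ** dagger F ** L2"
    using sim by (simp add: matrix_mul_assoc[symmetric])
  have K3: "K = dagger G ** L1 ** G - L2"
    using sum by (simp add: K_def algebra_simps)
  have hK: "dagger K = K"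
    by (simp add: K_def dagger_mult h matrix_mul_assoc)
  have "K = - (dagger (mat 1 - F ** G) ** L2)"
    by (simp add: K3 GLG dagger_mult matrix_ring_simps)
  then have K2: "K = - (L2 ** (mat 1 - F ** G))"
    using hK by (metis dagger_minus dagger_mult dagger_dagger h(2))
  have dK1: "det K = det L1 * w"
    by (simp add: K1 det_mul w_def)
  have dK2: "det K = det L2 * w"
    unfolding K2 by (simp add: det_minus_2 det_mul w')
  have w0: "w \<noteq> 0"
    using nz w' by simp
  \<comment> \<open>The two expressions for \<open>det K\<close> equate \<open>det L1\<close> and
    \<open>det L2\<close>; the determinant of \<open>sim\<close> then relates \<open>G\<close> and
    \<open>F\<close>.\<close>
  have dL: "det L1 = det L2"
    using dK1 dK2 w0 by simp
  have dF: "det G = cnj (det F)"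
    using arg_cong[OF sim, of det] L1(2) by (simp add: det_mul det_dagger dL)
  show "det G = cnj (det F)"
    by (rule dF)
  define R where "R = matrix_inv (mat 1 - F ** G)"
  note R = matrix_inv_mult[OF nz, folded R_def]
  have "dagger F = dagger F ** L2 ** matrix_inv L2"
    by (simp add: matrix_mul_assoc[symmetric] matrix_inv_mult[OF L2(2)])
  also have "\<dots> = L1 ** G ** matrix_inv L2"
    by (simp add: sim)
  finally have "trace (dagger F) = trace (matrix_inv L2 ** L1 ** G)"
    using trace_mul_sym[of "L1 ** G" "matrix_inv L2"] by (simp add: matrix_mul_assoc)
  \<comment> \<open>Writing \<open>G\<close> as \<open>(mat 1 - G ** F) ** G ** R\<close> exposes
    \<open>K\<close>, whose second expression cancels \<open>matrix_inv L2\<close>.\<close>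
  also have "matrix_inv L2 ** L1 ** G = matrix_inv L2 ** (L1 ** (mat 1 - G ** F)) ** G ** R"
  proof -
    have "(mat 1 - G ** F) ** G = G ** (mat 1 - F ** G)"
      by (simp add: matrix_ring_simps)
    then have "(mat 1 - G ** F) ** G ** R = G"
      by (simp add: matrix_mul_assoc[symmetric] R)
    then show ?thesis
      by (simp add: matrix_mul_assoc[symmetric])
  qed
  also have "L1 ** (mat 1 - G ** F) = - (L2 ** (mat 1 - F ** G))"
    using K1 K2 by simp
  also have "matrix_inv L2 ** - (L2 ** (mat 1 - F ** G)) ** G ** R = - ((mat 1 - F ** G) ** G ** R)"
    by (simp only: matrix_minus_right matrix_minus_left matrix_mul_assoc matrix_inv_mult[OF L2(2)] matrix_mul_lid)
  also have "trace \<dots> = - trace ((mat 1 - F ** G) ** (G ** R))"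
    by (simp add: trace_def sum_negf matrix_mul_assoc)
  also have "trace ((mat 1 - F ** G) ** (G ** R)) = trace G"
    using trace_mul_sym[of "mat 1 - F ** G" "G ** R"] R by (simp add: matrix_mul_assoc[symmetric])
  finally show "trace G = - cnj (trace F)"
    by (simp add: trace_dagger)
  have r: "det L1 = of_real (Re (det L1))" "0 < Re (det L1)"
    using psd_2_det[OF L1(1)] L1(2) by (auto simp: complex_eq_iff order_less_le)
  have "cnj (det K) = det K"
    using hK det_dagger[of K] by simp
  then have "cnj w = w"
    using dK1 r by (metis complex_cnj_complex_of_real complex_cnj_mult mult_cancel_left L1(2))
  then have w: "w = of_real (Re w)"
    by (simp add: complex_eq_iff)
  \<comment> \<open>If \<open>w\<close> were positive, \<open>K\<close> would be definite. Either
    sign gives one determinant inequality involving \<open>F\<close> and one involving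
    \<open>G\<close>; since \<open>det L1 = det L2\<close> and
    \<open>norm (det G) = norm (det F)\<close>, their sum is contradictory.\<close>
  have "\<not> 0 < Re w"
  proof
    assume "0 < Re w"
    then have "0 < Re (det K)"
      using dK1 r by (metis Re_complex_of_real mult_pos_pos of_real_mult w)
    have n: "Re (det (dagger M ** L ** M)) = (norm (det M))\<^sup>2 * Re (det L)" for M L :: "complex^2^2"
    proof -
      have "det (dagger M ** L ** M) = of_real ((norm (det M))\<^sup>2) * det L"
        unfolding complex_norm_square by (simp add: det_mul det_dagger)
      then show ?thesis by simp
    qed
    have p: "psd (dagger M ** L ** M)" if "psd L" for M L :: "complex^2^2"
      using psd_congruence[OF that, of "dagger M"] by simp
    have dG: "norm (det G) = norm (det F)"
      by (simp add: dF)
    from hermitian_2_definite[OF hK \<open>0 < Re (det K)\<close>] show False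
    proof
      assume K: "psd K"
      have "L1 = dagger F ** L2 ** F + K" "dagger G ** L1 ** G = L2 + K"
        by (simp_all add: K_def) (simp add: K3[unfolded K_def] algebra_simps)
      then show False
        using det_add_psd_2[OF p[OF L2(1), of F] K] det_add_psd_2[OF L2(1) K] n[of F L2] n[of G L1] dL dG
          \<open>0 < Re (det K)\<close> by simp
    next
      assume K: "psd (- K)"
      have "dagger F ** L2 ** F = L1 + - K" "L2 = dagger G ** L1 ** G + - K"
        by (simp add: K_def) (simp add: K3)
      then show False
        using det_add_psd_2[OF p[OF L1(1), of G] K] det_add_psd_2[OF L1(1) K] n[of F L2] n[of G L1] dL dG
          \<open>0 < Re (det K)\<close> by (simp add: det_minus_2)
    qed
  qed
  then show "norm (det (mat 1 - G ** F)) + Re (det (mat 1 - G ** F)) = 0"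
    unfolding w_def[symmetric] by (subst w) (simp add: abs_if)
qed

text \<open>Congruence by the inverse of a factor of \<open>m\<close> leads to
  \<open>gap_normal_form\<close> with \<open>x\<close> similar to \<open>G\<close> and
  \<open>dagger y\<close> similar to \<open>F\<close>. Similarity preserves traces and determinants,
  so all three terms vanish.\<close>

lemma gap_factorisation:
  fixes G F m :: "complex^2^2"
  assumes "psd m" and "det m \<noteq> 0" and "det G = cnj (det F)" "trace G = - cnj (trace F)"
    "norm (det (mat 1 - G ** F)) + Re (det (mat 1 - G ** F)) = 0"
  shows "gap (blk (m + G ** m ** dagger G) (G ** m + m ** dagger F) (dagger (G ** m + m ** dagger F))
    (m + F ** m ** dagger F)) = 0"
proof -
  obtain k :: "complex^2^2" where k: "m = k ** dagger k"
    by (rule psd_2_factor[OF assms(1)])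
  have "det k \<noteq> 0"
    using assms(2) k by (auto simp: det_mul)
  define g where "g = matrix_inv k"
  have kg: "k ** g = mat 1" and gk: "g ** k = mat 1"
    using matrix_inv_mult[OF \<open>det k \<noteq> 0\<close>] by (simp_all add: g_def)
  have kg': "M ** k ** g = M" "M ** dagger g ** dagger k = M" for M :: "complex^2^2"
    using kg by (simp_all add: matrix_mul_assoc[symmetric] dagger_mult[symmetric])
  define x where "x = g ** G ** k"
  define y where "y = dagger (g ** F ** k)"
  have det_sim: "det (g ** M ** k) = det M" for M
    using arg_cong[OF kg, of det] by (simp add: det_mul mult.commute)
  have tr_sim: "trace (g ** M ** k) = trace M" for M
    using trace_mul_sym[of g "M ** k"] kg by (simp add: matrix_mul_assoc[symmetric])
  have dx: "det x = det y" and tx: "trace x + trace y = 0"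
    using assms(3,4) by (simp_all add: x_def y_def det_dagger trace_dagger det_sim tr_sim)
  have "mat 1 - x ** dagger y = g ** (mat 1 - G ** F) ** k"
    by (simp add: x_def y_def matrix_ring_simps kg' gk)
  then have z: "det (mat 1 - x ** dagger y) = det (mat 1 - G ** F)"
    by (simp add: det_sim)
  have A: "m + G ** m ** dagger G = k ** (mat 1 + x ** dagger x) ** dagger k"
    and X: "G ** m + m ** dagger F = k ** (x + y) ** dagger k"
    and D: "m + F ** m ** dagger F = k ** (mat 1 + dagger y ** y) ** dagger k"
    by (simp_all add: x_def y_def k matrix_ring_simps dagger_mult kg kg')
  have "gap (blk (mat 1 + x ** dagger x) (x + y) (dagger (x + y)) (mat 1 + dagger y ** y)) = 0"
    unfolding gap_normal_form by (simp add: dx tx z assms(5) del: distrib_left_numeral)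
  then show ?thesis
    unfolding A X D by (subst gap_congruence) (simp_all add: dagger_mult)
qed

text \<open>A singular corner would make the dual element psd, and a psd matrix paired to 0 with a
  positive definite one is 0. So both corners are invertible and complementary slackness
  applies.\<close>

lemma optimal_pair_gap_zero:
  fixes L1 L2 \<Gamma> :: "complex^2^2"
  assumes dual: "\<And>w1 w2 w3. 0 \<le> dual_form L1 \<Gamma> L2 w1 w2 w3"
    and herm: "dagger L1 = L1" "dagger L2 = L2"
    and nz: "blk L1 \<Gamma> (dagger \<Gamma>) L2 \<noteq> 0"
    and 1: "psd (blk (A - m) x (dagger x) m)" and 2: "psd (blk m y (dagger y) (D - m))"
    and tr: "Re (trace (blk L1 \<Gamma> (dagger \<Gamma>) L2 ** blk A (x + y) (dagger (x + y)) D)) = 0"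
    and psd: "psd (blk A (x + y) (dagger (x + y)) D)"
    and det: "det (blk A (x + y) (dagger (x + y)) D) \<noteq> 0"
  shows "gap (blk A (x + y) (dagger (x + y)) D) = 0"
proof -
  have L1: "psd L1" and L2: "psd L2"
    using dual[of _ 0 0] dual[of 0 0] herm by (simp_all add: psd_iff dual_form_def)
  have "det L1 \<noteq> 0 \<and> det L2 \<noteq> 0"
  proof (rule ccontr)
    assume "\<not> ?thesis"
    then have "psd (blk L1 \<Gamma> (dagger \<Gamma>) L2)"
      by (intro dual_form_singular_either dual L1 L2) auto
    then have "blk L1 \<Gamma> (dagger \<Gamma>) L2 = 0"
      by (rule psd_blk_trace_mult_zero[OF _ psd det tr])
    then show False
      using nz by simp
  qed
  then have d: "det L1 \<noteq> 0" "det L2 \<noteq> 0"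
    by auto
  obtain G F where GF: "L1 ** G = dagger F ** L2" "L1 + L2 = dagger G ** L1 ** G + dagger F ** L2 ** F"
    "A = m + G ** m ** dagger G" "D = m + F ** m ** dagger F" "x + y = G ** m + m ** dagger F"
    "det (mat 1 - F ** G) \<noteq> 0" "psd m" "det m \<noteq> 0"
    by (rule complementary_slackness[OF dual L1 d(1) L2 d(2) 1 2 tr det])
  note inv = factorisation_invariants[OF L1 d(1) L2 d(2) GF(1,2,6)]
  show ?thesis
    unfolding GF(3-5) by (rule gap_factorisation[OF GF(7,8) inv])
qed

section \<open>Convex duality\<close>

lemma psd_diag_nonneg: "psd M \<Longrightarrow> 0 \<le> Re (M $ i $ i)"
  using psd_2_entries(4)[OF psd_submatrix[of M "\<lambda>_::2. i"]] by simp

lemma psd_diag_le_trace: "psd M \<Longrightarrow> Re (M $ i $ i) \<le> Re (trace M)"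
  using member_le_sum[of i UNIV "\<lambda>i. Re (M $ i $ i)"] by (simp add: trace_def psd_diag_nonneg)

text \<open>Minors of two-index principal submatrices bound each entry by diagonal ones. This gives
  boundedness of the states, and later of a slice of the dual cone.\<close>

lemma psd_entry_le_trace:
  assumes "psd M"
  shows "norm (M $ i $ j) \<le> Re (trace M)"
proof (rule power2_le_imp_le)
  define f :: "2 \<Rightarrow> 'a" where "f k = (if k = 1 then i else j)" for k
  have "(norm (M $ i $ j))\<^sup>2 \<le> Re (M $ i $ i) * Re (M $ j $ j)"
    using psd_2_entries(6)[OF psd_submatrix[OF assms, of f]] by (simp add: f_def)
  also have "\<dots> \<le> (Re (trace M))\<^sup>2"
    unfolding power2_eq_square using assms
    by (intro mult_mono psd_diag_le_trace psd_diag_nonneg order_trans[OF psd_diag_nonneg psd_diag_le_trace])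
  finally show "(norm (M $ i $ j))\<^sup>2 \<le> (Re (trace M))\<^sup>2" .
  show "0 \<le> Re (trace M)"
    using order_trans[OF psd_diag_nonneg psd_diag_le_trace, OF assms assms] .
qed

lemma bounded_matrix_entries:
  fixes S :: "('a::real_normed_vector^'n^'m) set"
  assumes "\<And>M i j. M \<in> S \<Longrightarrow> norm (M $ i $ j) \<le> c"
  shows "bounded S"
proof (rule boundedI)
  fix M assume "M \<in> S"
  have "norm M \<le> (\<Sum>i\<in>UNIV. norm (M $ i))"
    unfolding norm_vec_def[of M] by (rule L2_set_le_sum) simp
  also have "\<dots> \<le> (\<Sum>i\<in>(UNIV::'m set). \<Sum>j\<in>(UNIV::'n set). c)"
  proof (rule sum_mono)
    fix i
    have "norm (M $ i) \<le> (\<Sum>j\<in>UNIV. norm (M $ i $ j))"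
      unfolding norm_vec_def[of "M $ i"] by (rule L2_set_le_sum) simp
    also have "\<dots> \<le> (\<Sum>j\<in>(UNIV::'n set). c)"
      using assms[OF \<open>M \<in> S\<close>] by (intro sum_mono) auto
    finally show "norm (M $ i) \<le> (\<Sum>j\<in>(UNIV::'n set). c)" .
  qed
  finally show "norm M \<le> (\<Sum>i\<in>(UNIV::'m set). \<Sum>j\<in>(UNIV::'n set). c)" .
qed

lemma closed_hermitian: "closed {M. hermitian M}"
  unfolding hermitian_def by (intro closed_Collect_all closed_Collect_eq continuous_intros)

lemma closed_psd: "closed {M. psd M}"
  unfolding psd_def matrix_vector_mult_def vec_lambda_beta
  by (intro closed_Collect_conj closed_hermitian closed_Collect_all closed_Collect_le continuous_intros)

lemma closed_trace: "closed {M. trace M = (c :: complex)}"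
  unfolding trace_def by (intro closed_Collect_eq continuous_intros)

lemma compact_state: "compact {M. state M}"
proof -
  have "closed {M. state M}"
    unfolding state_def by (intro closed_Collect_conj closed_psd closed_trace)
  moreover have "bounded {M. state M}"
    by (rule bounded_matrix_entries[of _ 1]) (metis psd_entry_le_trace state_def mem_Collect_eq one_complex.sel(1))
  ultimately show ?thesis
    by (simp add: compact_eq_bounded_closed)
qed

lemma ptrace_B'_add: "ptrace_B' (M + N) = ptrace_B' M + ptrace_B' N"
  and ptrace_B_add: "ptrace_B (M + N) = ptrace_B M + ptrace_B N"
  by (simp_all add: ptrace_B'_def ptrace_B_def vec_eq_iff sum.distrib)

lemma ptrace_B'_scaleR: "ptrace_B' (r *\<^sub>R M) = r *\<^sub>R ptrace_B' M"
  and ptrace_B_scaleR: "ptrace_B (r *\<^sub>R M) = r *\<^sub>R ptrace_B M"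
  by (simp_all add: ptrace_B'_def ptrace_B_def vec_eq_iff scaleR_sum_right)

lemma ptrace_B'_0: "ptrace_B' 0 = 0"
  by (simp add: ptrace_B'_def vec_eq_iff)

lemma sum_UNIV_prod: "(\<Sum>i\<in>UNIV. f i) = (\<Sum>a\<in>UNIV. \<Sum>b\<in>UNIV. f (a, b))"
  for f :: "'a::finite \<times> 'b::finite \<Rightarrow> 'c::comm_monoid_add"
  by (simp add: sum.cartesian_product)

lemma trace_ptrace_B': "trace (ptrace_B' M) = trace M"
  by (simp add: trace_def ptrace_B'_def sum_UNIV_prod)

lemma trace_scaleR: "trace (r *\<^sub>R M) = r *\<^sub>R trace (M :: complex^'n^'n)"
  by (simp add: trace_def scaleR_sum_right)

text \<open>The set is the continuous image, under a partial trace, of the compact set of states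
  with equal marginals.\<close>

lemma compact_symmetric_extendible:
  "compact {\<rho> :: complex^('a::finite \<times> 'b::finite)^('a \<times> 'b). symmetric_extendible \<rho>}"
proof -
  let ?S = "{\<sigma> :: complex^('a \<times> 'b \<times> 'b)^('a \<times> 'b \<times> 'b). state \<sigma>} \<inter> {\<sigma>. ptrace_B' \<sigma> = ptrace_B \<sigma>}"
  have c: "continuous_on S ptrace_B'" "continuous_on S ptrace_B" for S :: "(complex^('a \<times> 'b \<times> 'b)^('a \<times> 'b \<times> 'b)) set"
    unfolding ptrace_B'_def ptrace_B_def by (intro continuous_intros)+
  have "compact ?S"
    by (intro compact_Int_closed compact_state closed_Collect_eq c)
  then have "compact (ptrace_B' ` ?S)"
    by (intro compact_continuous_image c)
  moreover have "ptrace_B' ` ?S = {\<rho>. symmetric_extendible \<rho>}"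
    by (force simp: symmetric_extendible_def image_iff)
  ultimately show ?thesis by simp
qed

lemma convex_symmetric_extendible:
  "convex {\<rho> :: complex^('a::finite \<times> 'b::finite)^('a \<times> 'b). symmetric_extendible \<rho>}"
proof (rule convexI, unfold mem_Collect_eq)
  fix x y :: "complex^('a \<times> 'b)^('a \<times> 'b)" and u v :: real
  assume "symmetric_extendible x" "symmetric_extendible y" and uv: "0 \<le> u" "0 \<le> v" "u + v = 1"
  then obtain s t where "state s" "ptrace_B' s = x" "ptrace_B s = x" "state t" "ptrace_B' t = y" "ptrace_B t = y"
    by (auto simp: symmetric_extendible_def)
  then show "symmetric_extendible (u *\<^sub>R x + v *\<^sub>R y)"
    unfolding symmetric_extendible_def using uv
    by (intro exI[of _ "u *\<^sub>R s + v *\<^sub>R t"])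
       (auto simp: state_def psd_add psd_scaleR trace_add trace_scaleR ptrace_B'_add ptrace_B_add
         ptrace_B'_scaleR ptrace_B_scaleR scaleR_conv_of_real[where 'a=complex] simp flip: of_real_add)
qed

section \<open>The cone of extendible operators and its dual\<close>

definition ext_cone :: "(complex^('a::finite \<times> 'b::finite)^('a \<times> 'b)) set" where
  "ext_cone = {\<rho>. \<exists>\<sigma> :: complex^('a \<times> 'b \<times> 'b)^('a \<times> 'b \<times> 'b).
     psd \<sigma> \<and> ptrace_B' \<sigma> = \<rho> \<and> ptrace_B \<sigma> = \<rho>}"

text \<open>The dual cone for the trace pairing; a negative pairing with one of its elements
  certifies that an operator is not extendible.\<close>

definition ext_dual :: "(complex^('a::finite \<times> 'b::finite)^('a \<times> 'b)) set" where
  "ext_dual = {H. hermitian H \<and> (\<forall>\<rho>\<in>ext_cone. 0 \<le> Re (trace (H ** \<rho>)))}"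

lemma ext_cone_cases:
  assumes "\<rho> \<in> ext_cone"
  obtains "\<rho> = 0" | r \<rho>' where "0 < r" "symmetric_extendible \<rho>'" "\<rho> = r *\<^sub>R \<rho>'"
proof -
  obtain \<sigma> where s: "psd \<sigma>" "ptrace_B' \<sigma> = \<rho>" "ptrace_B \<sigma> = \<rho>"
    using assms by (auto simp: ext_cone_def)
  let ?r = "Re (trace \<sigma>)"
  have tr: "trace \<sigma> = of_real ?r"
    using trace_dagger[of \<sigma>] psd_dagger[OF s(1)] by (simp add: complex_eq_iff)
  have r: "0 \<le> ?r"
    using order_trans[OF psd_diag_nonneg psd_diag_le_trace, OF s(1) s(1)] .
  show thesis
  proof (cases "?r = 0")
    case True
    then have "\<sigma> = 0"
      by (rule psd_trace_zero[OF s(1)])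
    then show thesis
      using s(2) that(1) by (simp add: ptrace_B'_0)
  next
    case False
    have "symmetric_extendible ((1 / ?r) *\<^sub>R \<rho>)"
      unfolding symmetric_extendible_def using s r tr False
      by (intro exI[of _ "(1 / ?r) *\<^sub>R \<sigma>"])
         (auto simp: state_def psd_scaleR trace_scaleR ptrace_B'_scaleR ptrace_B_scaleR scaleR_conv_of_real[where 'a=complex] simp flip: of_real_mult)
    moreover have "\<rho> = ?r *\<^sub>R ((1 / ?r) *\<^sub>R \<rho>)"
      using False by simp
    ultimately show thesis
      using False r by (intro that(2)[of ?r]) auto
  qed
qed

lemma inner_matrix: "inner M N = Re (trace (dagger M ** (N :: complex^'n^'m)))"
proof -
  have "inner M N = (\<Sum>i\<in>UNIV. \<Sum>j\<in>UNIV. Re (cnj (M $ i $ j) * N $ i $ j))"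
    by (simp add: inner_vec_def inner_complex_def)
  also have "\<dots> = (\<Sum>j\<in>UNIV. \<Sum>i\<in>UNIV. Re (cnj (M $ i $ j) * N $ i $ j))"
    by (rule sum.swap)
  finally show ?thesis
    by (simp add: trace_def matrix_matrix_mult_def)
qed

lemma scaleR_matrix_mult: "(r *\<^sub>R M) ** N = r *\<^sub>R (M ** (N :: complex^'k^'n))"
  "M ** (r *\<^sub>R N) = r *\<^sub>R (M ** (N :: complex^'k^'n))"
  by (simp_all add: vec_eq_iff matrix_matrix_mult_def scaleR_sum_right)

lemma ext_dual_separation:
  fixes \<rho> :: "complex^('a::finite \<times> 'b::finite)^('a \<times> 'b)"
  assumes "hermitian \<rho>" "trace \<rho> = 1" "\<not> symmetric_extendible \<rho>"
  obtains H where "H \<in> ext_dual" "Re (trace (H ** \<rho>)) < 0"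
proof -
  obtain a b where a: "inner a \<rho> < b" and b: "\<And>x. symmetric_extendible x \<Longrightarrow> b < inner a x"
    using separating_hyperplane_closed_point[OF convex_symmetric_extendible
        compact_imp_closed[OF compact_symmetric_extendible], of \<rho>] assms(3) by blast
  \<comment> \<open>Hermitian matrices see only the Hermitian part of \<open>a\<close>, and on
    trace-one matrices the constant \<open>b\<close> is the pairing with
    \<open>b *\<^sub>R mat 1\<close>. This makes the separating affine functional linear.\<close>
  define H where "H = (1 / 2) *\<^sub>R (a + dagger a) - b *\<^sub>R mat 1"
  have H: "Re (trace (H ** x)) = inner a x - b * Re (trace x)" if "dagger x = x" for x
  proof -
    have "trace (a ** x) = cnj (trace (dagger a ** x))"
      using trace_dagger[of "a ** x"] trace_mul_sym[of x "dagger a"] that by (simp add: dagger_mult)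
    then show ?thesis
      by (simp add: H_def matrix_ring_simps scaleR_matrix_mult trace_add trace_sub trace_scaleR inner_matrix scaleR_add_right)
  qed
  have "Re (trace (H ** \<rho>)) < 0"
    using H a assms by (simp add: hermitian_iff_dagger)
  moreover have "H \<in> ext_dual"
    unfolding ext_dual_def
  proof (intro CollectI conjI ballI)
    show "hermitian H"
      by (simp add: H_def hermitian_iff_dagger add.commute)
    fix x :: "complex^('a \<times> 'b)^('a \<times> 'b)" assume "x \<in> ext_cone"
    then show "0 \<le> Re (trace (H ** x))"
    proof (cases rule: ext_cone_cases)
      case 1
      then show ?thesis by (simp add: trace_def)
    next
      case (2 r x')
      obtain \<sigma> :: "complex^('a \<times> 'b \<times> 'b)^('a \<times> 'b \<times> 'b)" where s: "state \<sigma>" "ptrace_B' \<sigma> = x'"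
        using 2 by (auto simp: symmetric_extendible_def)
      have "dagger x' = x'"
        using psd_dagger[of \<sigma>] s by (simp add: state_def vec_eq_iff ptrace_B'_def s(2)[symmetric])
      moreover have "trace x' = 1"
        using s trace_ptrace_B'[of \<sigma>] by (simp add: state_def)
      ultimately show ?thesis
        using 2 H[of x'] b[of x'] by (simp add: scaleR_matrix_mult trace_scaleR)
    qed
  qed
  ultimately show thesis
    by (rule that[rotated])
qed

text \<open>The vector \<open>v\<close> is symmetric under the exchange of B and B', so its rank-one
  operator has equal marginals and \<open>?R\<close> lies in \<open>ext_cone\<close>.\<close>

lemma ext_dual_form:
  assumes "blk L1 G (dagger G) L2 \<in> ext_dual"
  shows "0 \<le> dual_form L1 G L2 w1 w2 w3"
proof -
  define v :: "complex^('a \<times> 2 \<times> 2)" where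
    "v = (\<chi> i. (if fst (snd i) = 1 then if snd (snd i) = 1 then w1 else w2
       else if snd (snd i) = 1 then w2 else w3) $ fst i)"
  let ?R = "blk (outer w1 w1 + outer w2 w2) (outer w1 w2 + outer w2 w3)
    (outer w2 w1 + outer w3 w2) (outer w2 w2 + outer w3 w3)"
  have "ptrace_B' (outer v v) = ?R" "ptrace_B (outer v v) = ?R"
    by (simp_all add: vec_eq_iff_prod_2 ptrace_B'_def ptrace_B_def v_def outer_def sum_2)
  then have "?R \<in> ext_cone"
    using psd_outer[of v] by (auto simp: ext_cone_def)
  then have "0 \<le> Re (trace (blk L1 G (dagger G) L2 ** ?R))"
    using assms by (auto simp: ext_dual_def)
  also have "Re (trace (blk L1 G (dagger G) L2 ** ?R)) = dual_form L1 G L2 w1 w2 w3"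
    using cip_commute[of "G *v w2" w1] cip_commute[of "G *v w3" w2]
    by (simp add: blk_mult trace_blk trace_add matrix_ring_simps trace_mult_outer dual_form_def
        matrix_vector_mult_add_rdistrib cip_add_right cip_matrix[of _ "dagger G"])
  finally show ?thesis .
qed

text \<open>Vectors with \<open>w3 = 0\<close> place \<open>G\<close> in a psd block matrix with
  corners \<open>L1\<close> and \<open>L1 + L2\<close>, whose trace is at most twice that of
  \<open>H\<close>. The bound makes the trace-one slice of the dual cone bounded.\<close>

lemma ext_dual_entry_le_trace:
  fixes H :: "complex^(2 \<times> 2)^(2 \<times> 2)"
  assumes "H \<in> ext_dual"
  shows "norm (H $ i $ j) \<le> 2 * Re (trace H)"
proof -
  obtain L1 G C L2 where H: "H = blk L1 G C L2"
    by (rule blk_exhaust)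
  have h: "dagger L1 = L1" "dagger L2 = L2" "C = dagger G"
    using assms by (auto simp: H ext_dual_def hermitian_iff_dagger dagger_blk blk_eq_iff)
  note d = ext_dual_form[OF assms[unfolded H h(3)]]
  have L1: "psd L1" and L2: "psd L2"
    using d[of _ 0 0] d[of 0 0] h by (simp_all add: psd_iff dual_form_def)
  have M: "psd (blk L1 G (dagger G) (L1 + L2))"
    using d[of _ _ 0] h by (simp add: psd_blk_iff dual_form_def)
      (simp add: add.assoc add.commute add.left_commute)
  have t: "0 \<le> Re (trace L1)" "0 \<le> Re (trace L2)"
    using psd_2_trace L1 L2 by auto
  have M': "norm (blk L1 G (dagger G) (L1 + L2) $ i $ j) \<le> 2 * Re (trace H)"
    using psd_entry_le_trace[OF M, of i j] t by (simp add: H trace_blk trace_add)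
  have L2': "norm (L2 $ a $ b) \<le> 2 * Re (trace H)" for a b
    using psd_entry_le_trace[OF L2, of a b] t by (simp add: H trace_blk)
  obtain a b a' b' where ij: "i = (a, b)" "j = (a', b')"
    by fastforce
  show ?thesis
    using M' L2'[of a a'] exhaust_2[of b] exhaust_2[of b'] by (auto simp: ij H h(3))
qed

lemma ext_dual_trace:
  fixes H :: "complex^(2 \<times> 2)^(2 \<times> 2)"
  assumes "H \<in> ext_dual" and "H \<noteq> 0"
  shows "trace H = of_real (Re (trace H))" "0 < Re (trace H)"
proof -
  have "dagger H = H"
    using assms(1) by (simp add: ext_dual_def hermitian_iff_dagger)
  then show "trace H = of_real (Re (trace H))"
    using trace_dagger[of H] by (simp add: complex_eq_iff)
  have "\<exists>i j. H $ i $ j \<noteq> 0"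
    using assms(2) by (auto simp: vec_eq_iff)
  then obtain i j where "0 < norm (H $ i $ j)"
    by auto
  then show "0 < Re (trace H)"
    using ext_dual_entry_le_trace[OF assms(1), of i j] by linarith
qed

lemma ext_dual_scaleR: "0 \<le> r \<Longrightarrow> H \<in> ext_dual \<Longrightarrow> r *\<^sub>R H \<in> ext_dual"
  by (simp add: ext_dual_def hermitian_iff_dagger scaleR_matrix_mult trace_scaleR)

lemma compact_ext_dual_slice: "compact {H :: complex^(2 \<times> 2)^(2 \<times> 2). H \<in> ext_dual \<and> trace H = 1}"
proof -
  have eq: "{H :: complex^(2 \<times> 2)^(2 \<times> 2). H \<in> ext_dual} =
      {H. hermitian H} \<inter> (\<Inter>\<rho>\<in>ext_cone. {H. 0 \<le> Re (trace (H ** \<rho>))})"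
    by (auto simp: ext_dual_def)
  have cl: "closed {H :: complex^(2 \<times> 2)^(2 \<times> 2). 0 \<le> Re (trace (H ** \<rho>))}" for \<rho>
    unfolding trace_def matrix_matrix_mult_def vec_lambda_beta
    by (intro closed_Collect_le continuous_intros)
  have "closed {H :: complex^(2 \<times> 2)^(2 \<times> 2). H \<in> ext_dual}"
    unfolding eq by (intro closed_Int closed_INT ballI closed_hermitian cl)
  then have "closed {H :: complex^(2 \<times> 2)^(2 \<times> 2). H \<in> ext_dual \<and> trace H = 1}"
    by (intro closed_Collect_conj closed_trace)
  moreover have "bounded {H :: complex^(2 \<times> 2)^(2 \<times> 2). H \<in> ext_dual \<and> trace H = 1}"
    by (rule bounded_matrix_entries[of _ 2]) (use ext_dual_entry_le_trace in fastforce)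
  ultimately show ?thesis
    by (simp add: compact_eq_bounded_closed)
qed

text \<open>\<open>H\<close> minimises the pairing with \<open>\<rho>\<close> over the compact
  trace-one slice, and \<open>- s\<close> is the minimum. The identity pairs to 1 with the slice, so
  every dual element pairs nonnegatively with \<open>\<rho> + s *\<^sub>R mat 1\<close>; by
  separation this operator is extendible after normalisation.\<close>

lemma optimal_pair:
  fixes \<rho> :: "complex^(2 \<times> 2)^(2 \<times> 2)"
  assumes "hermitian \<rho>" "trace \<rho> = 1" "\<not> symmetric_extendible \<rho>"
  obtains H s where "0 < s" "H \<in> ext_dual" "H \<noteq> 0" "\<rho> + s *\<^sub>R mat 1 \<in> ext_cone"
    "Re (trace (H ** (\<rho> + s *\<^sub>R mat 1))) = 0"
proof -
  let ?K = "{H :: complex^(2 \<times> 2)^(2 \<times> 2). H \<in> ext_dual \<and> trace H = 1}"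
  have normalise: "\<exists>H'\<in>?K. Re (trace (H' ** \<tau>)) < 0" if "H \<in> ext_dual" "Re (trace (H ** \<tau>)) < 0" for H \<tau>
  proof -
    have "H \<noteq> 0"
      using that(2) by (auto simp: trace_def)
    note t = ext_dual_trace[OF that(1) this]
    let ?t = "1 / Re (trace H)"
    have "trace (?t *\<^sub>R H) = 1"
      using t(2) arg_cong[OF t(1), of Im] by (simp add: trace_scaleR complex_eq_iff)
    moreover have "Re (trace (?t *\<^sub>R H ** \<tau>)) < 0"
      using t(2) that(2) by (simp add: scaleR_matrix_mult trace_scaleR divide_neg_pos)
    moreover have "?t *\<^sub>R H \<in> ext_dual"
      using t(2) that(1) by (intro ext_dual_scaleR) auto
    ultimately show ?thesis by blast
  qed
  obtain H0 where "H0 \<in> ext_dual" "Re (trace (H0 ** \<rho>)) < 0"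
    using assms by (rule ext_dual_separation)
  then obtain H1 where H1: "H1 \<in> ?K" "Re (trace (H1 ** \<rho>)) < 0"
    using normalise by blast
  have "continuous_on ?K (\<lambda>H. Re (trace (H ** \<rho>)))"
    unfolding trace_def matrix_matrix_mult_def vec_lambda_beta by (intro continuous_intros)
  then have "\<exists>H\<in>?K. \<forall>H'\<in>?K. Re (trace (H ** \<rho>)) \<le> Re (trace (H' ** \<rho>))"
    using H1(1) by (intro continuous_attains_inf[OF compact_ext_dual_slice]) auto
  then obtain H where H: "H \<in> ?K" and min: "\<And>H'. H' \<in> ?K \<Longrightarrow> Re (trace (H ** \<rho>)) \<le> Re (trace (H' ** \<rho>))"
    by blast
  define s where "s = - Re (trace (H ** \<rho>))"
  have s: "0 < s"
    using min[OF H1(1)] H1(2) by (simp add: s_def)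
  have shift: "Re (trace (H' ** (\<rho> + s *\<^sub>R mat 1))) = Re (trace (H' ** \<rho>)) + s" if "H' \<in> ?K" for H'
    using that by (simp add: matrix_add_ldistrib scaleR_matrix_mult trace_add trace_scaleR)
  \<comment> \<open>The trace of \<open>\<rho> + s *\<^sub>R mat 1\<close> is
    \<open>1 + 4 * s\<close>.\<close>
  let ?c = "1 / (1 + 4 * s)"
  let ?\<rho> = "?c *\<^sub>R (\<rho> + s *\<^sub>R mat 1)"
  have c: "0 < ?c"
    using s by simp
  have "symmetric_extendible ?\<rho>"
  proof (rule ccontr)
    assume n: "\<not> symmetric_extendible ?\<rho>"
    have "hermitian ?\<rho>"
      using assms(1) by (simp add: hermitian_iff_dagger)
    moreover have "trace ?\<rho> = 1"
      using s by (simp add: trace_scaleR trace_add assms(2) trace_I complex_eq_iff field_simps)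
    ultimately obtain H2 where "H2 \<in> ext_dual" "Re (trace (H2 ** ?\<rho>)) < 0"
      using n by (rule ext_dual_separation)
    then obtain H' where H': "H' \<in> ?K" "Re (trace (H' ** ?\<rho>)) < 0"
      using normalise by blast
    then have "Re (trace (H' ** (\<rho> + s *\<^sub>R mat 1))) < 0"
      using c by (simp add: scaleR_matrix_mult trace_scaleR mult_less_0_iff divide_less_0_iff)
    then show False
      using min[OF H'(1)] shift[OF H'(1)] by (simp add: s_def)
  qed
  then obtain \<sigma> :: "complex^(2 \<times> 2 \<times> 2)^(2 \<times> 2 \<times> 2)"
    where "psd \<sigma>" "ptrace_B' \<sigma> = ?\<rho>" "ptrace_B \<sigma> = ?\<rho>"
    by (auto simp: symmetric_extendible_def state_def)
  then have "\<rho> + s *\<^sub>R mat 1 \<in> ext_cone"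
    unfolding ext_cone_def using s
    by (intro CollectI exI[of _ "(1 + 4 * s) *\<^sub>R \<sigma>"]) (simp add: psd_scaleR ptrace_B'_scaleR ptrace_B_scaleR)
  moreover have "H \<noteq> 0"
    using H by (auto simp: trace_def)
  ultimately show thesis
    using that[of s H] s H shift[OF H] by (simp add: s_def)
qed

lemma det_add_pos_scalar:
  assumes "psd M" and "0 < s"
  shows "det (M + s *\<^sub>R mat 1) \<noteq> 0"
proof
  assume "det (M + s *\<^sub>R mat 1) = 0"
  then obtain v where v: "v \<noteq> 0" "(M + s *\<^sub>R mat 1) *v v = 0"
    using det_zero_ker by blast
  have "Re (cip v ((M + s *\<^sub>R mat 1) *v v)) = Re (cip v (M *v v)) + s * (norm v)\<^sup>2"
    by (simp add: matrix_vector_mult_add_rdistrib cip_add_right scaleR_matrix_vector cip_smult_right cip_self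
        del: of_real_power)
  moreover have "0 < s * (norm v)\<^sup>2"
    using v assms(2) by simp
  ultimately show False
    using v psd_cip[OF assms(1), of v] by simp
qed

section \<open>The two directions of the criterion\<close>

lemma extendible_imp_gap_nonneg:
  assumes "symmetric_extendible \<rho>"
  shows "0 \<le> gap \<rho>"
proof -
  obtain \<sigma> :: "complex^(2 \<times> 2 \<times> 2)^(2 \<times> 2 \<times> 2)"
    where s: "psd \<sigma>" "ptrace_B' \<sigma> = \<rho>" "ptrace_B \<sigma> = \<rho>"
    using assms by (auto simp: symmetric_extendible_def state_def)
  obtain A X C D where \<rho>: "\<rho> = blk A X C D"
    by (rule blk_exhaust)
  have "dagger \<rho> = \<rho>"
    using arg_cong[OF psd_dagger[OF s(1)], of ptrace_B'] unfolding s(2)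
    by (simp add: vec_eq_iff ptrace_B'_def s(2)[symmetric])
  then have C: "C = dagger X"
    by (auto simp: \<rho> dagger_blk blk_eq_iff)
  obtain m x y where "psd (blk (A - m) x (dagger x) m)" "psd (blk m y (dagger y) (D - m))" "X = x + y"
    using s unfolding \<rho> by (rule extension_blocks)
  then show ?thesis
    using gap_nonneg unfolding \<rho> C by metis
qed

lemma gap_nonneg_imp_extendible:
  assumes "state \<rho>" and "0 \<le> gap \<rho>"
  shows "symmetric_extendible \<rho>"
proof (rule ccontr)
  assume n: "\<not> symmetric_extendible \<rho>"
  have \<rho>: "psd \<rho>" "trace \<rho> = 1" "hermitian \<rho>"
    using assms(1) by (auto simp: state_def psd_def)
  obtain H s where s: "0 < s" and H: "H \<in> ext_dual" "H \<noteq> 0" "\<rho> + s *\<^sub>R mat 1 \<in> ext_cone"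
    "Re (trace (H ** (\<rho> + s *\<^sub>R mat 1))) = 0"
    by (rule optimal_pair[OF \<rho>(3,2) n])
  let ?\<rho> = "\<rho> + s *\<^sub>R mat 1"
  obtain A X C D where b: "?\<rho> = blk A X C D"
    by (rule blk_exhaust)
  obtain L1 G C' L2 where Hb: "H = blk L1 G C' L2"
    by (rule blk_exhaust)
  have p: "psd ?\<rho>"
    using \<rho>(1) s by (intro psd_add psd_scaleR psd_mat_1) auto
  have C: "C = dagger X"
    using p by (simp add: b psd_blk_iff)
  have h: "dagger L1 = L1" "dagger L2 = L2" "C' = dagger G"
    using H(1) by (auto simp: Hb ext_dual_def hermitian_iff_dagger dagger_blk blk_eq_iff)
  obtain \<sigma> :: "complex^(2 \<times> 2 \<times> 2)^(2 \<times> 2 \<times> 2)"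
    where e: "psd \<sigma>" "ptrace_B' \<sigma> = blk A X C D" "ptrace_B \<sigma> = blk A X C D"
    using H(3) unfolding b by (auto simp: ext_cone_def)
  obtain m x y where m: "psd (blk (A - m) x (dagger x) m)" "psd (blk m y (dagger y) (D - m))" "X = x + y"
    using e by (rule extension_blocks)
  have "gap (blk A (x + y) (dagger (x + y)) D) = 0"
  proof (rule optimal_pair_gap_zero[OF _ h(1,2) _ m(1,2)])
    show "0 \<le> dual_form L1 G L2 w1 w2 w3" for w1 w2 w3
      using H(1) unfolding Hb h(3) by (rule ext_dual_form)
    show "blk L1 G (dagger G) L2 \<noteq> 0"
      using H(2) unfolding Hb h(3) .
    show "Re (trace (blk L1 G (dagger G) L2 ** blk A (x + y) (dagger (x + y)) D)) = 0"
      using H(4) unfolding b Hb h(3) C m(3) .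
    show "psd (blk A (x + y) (dagger (x + y)) D)"
      using p unfolding b C m(3) .
    show "det (blk A (x + y) (dagger (x + y)) D) \<noteq> 0"
      using det_add_pos_scalar[OF \<rho>(1) s] unfolding b C m(3) .
  qed
  then have "gap ?\<rho> = 0"
    unfolding b C m(3) .
  \<comment> \<open>The trace of \<open>\<rho>\<close> is positive, so the gap grows strictly from a
    nonnegative value at \<open>\<rho>\<close> and cannot be 0 at \<open>?\<rho>\<close>.\<close>
  with gap_strict_mono[OF \<rho>(1) _ s] \<rho>(2) assms(2) show False
    by simp
qed

(* The traces and the determinant are those of Hermitian matrices (or products M ** M of such),
   hence real, and det \<rho> is nonnegative; Re only moves them to the type real. *)
theorem theorem1:
  fixes \<rho> :: "complex^(2 \<times> 2)^(2 \<times> 2)"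
  assumes "state \<rho>"
  shows "symmetric_extendible \<rho> \<longleftrightarrow>
    Re (trace (ptrace_A \<rho> ** ptrace_A \<rho>)) \<ge> Re (trace (\<rho> ** \<rho>)) - 4 * sqrt (Re (det \<rho>))"
proof -
  have "symmetric_extendible \<rho> \<longleftrightarrow> 0 \<le> gap \<rho>"
    using extendible_imp_gap_nonneg gap_nonneg_imp_extendible[OF assms] by blast
  then show ?thesis
    by (auto simp: gap_def)
qed

end
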